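(* Let $A$ be a closed hyponormal operator in a complex Hilbert space $H$. Then $$\left|\overline{\mathrm{Re}\, A}\right|\leq |A|,$$ where $\overline{\mathrm{Re}\, A}$ denotes the closure of $\mathrm{Re}\, A$.
   Context: Operators are linear, not necessarily bounded, defined on a subspace $D(T)$ of $H$. A densely defined operator $T$ is hyponormal if $D(T)\subset D(T^* )$ and $\|T^*x\|\le\|Tx\|$ for all $x\in D(T)$. For a densely defined $T$, $\mathrm{Re}\,T=\frac{T+T^*}{2}$ with domain $D(T)\cap D(T^* )$. For a closed densely defined operator $T$, $|T|$ denotes the unique positive self-adjoint square root of $T^*T$. For positive self-adjoint operators $S,T$ (possibly unbounded), $T\le S$ means $D(S^{1/2})\subset D(T^{1/2})$ and $\|T^{1/2}x\|\le\|S^{1/2}x\|$ for all $x\in D(S^{1/2})$. *)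

theory Defs
  imports "HOL-Analysis.Analysis"
begin

text \<open>Complex Hilbert spaces, as a class on top of the library's complete real inner product
  spaces: the real inner product is the real part of the complex one, so that norm, metric and
  completeness are those of the library. The complex inner product is linear in its first argument;
  positive definiteness is inherited from \<^class>\<open>real_inner\<close>.\<close>

class complex_hilbert_space = real_inner + complete_space +
  fixes scaleC :: "complex \<Rightarrow> 'a \<Rightarrow> 'a" (infixr "*\<^sub>C" 75)
    and cinner :: "'a \<Rightarrow> 'a \<Rightarrow> complex"
  assumes scaleC_add_right: "c *\<^sub>C (x + y) = c *\<^sub>C x + c *\<^sub>C y"
    and scaleC_add_left: "(c + d) *\<^sub>C x = c *\<^sub>C x + d *\<^sub>C x"
    and scaleC_scaleC: "c *\<^sub>C (d *\<^sub>C x) = (c * d) *\<^sub>C x"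
    and scaleC_of_real: "complex_of_real r *\<^sub>C x = r *\<^sub>R x"
    and cinner_commute: "cinner x y = cnj (cinner y x)"
    and cinner_add_left: "cinner (x + y) z = cinner x z + cinner y z"
    and cinner_scaleC_left: "cinner (c *\<^sub>C x) y = c * cinner x y"
    and inner_eq_Re_cinner: "inner x y = Re (cinner x y)"

instantiation complex :: complex_hilbert_space
begin

definition scaleC_complex :: "complex \<Rightarrow> complex \<Rightarrow> complex" where
  "scaleC_complex c x = c * x"

definition cinner_complex :: "complex \<Rightarrow> complex \<Rightarrow> complex" where
  "cinner_complex x y = x * cnj y"

instance
  by standard
    (simp_all add: scaleC_complex_def cinner_complex_def algebra_simps scaleR_conv_of_real
      inner_complex_def)

end

text \<open>Operators are represented by their graphs, so the domain of \<open>T\<close> is \<^term>\<open>Domain T\<close>,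
  \<open>T\<close> is a closed operator iff \<^prop>\<open>closed T\<close> in the product topology, and the closure of a
  closable operator is \<^term>\<open>closure T\<close>.\<close>

type_synonym 'a graph = "('a \<times> 'a) set"

definition linear_operator :: "'a::complex_hilbert_space graph \<Rightarrow> bool" where
  "linear_operator T \<longleftrightarrow>
     single_valued T \<and> subspace T \<and> (\<forall>c x y. (x, y) \<in> T \<longrightarrow> (c *\<^sub>C x, c *\<^sub>C y) \<in> T)"

text \<open>Only meaningful for \<open>x\<close> in the domain of a single-valued \<open>T\<close>.\<close>

definition op_app :: "'a graph \<Rightarrow> 'a \<Rightarrow> 'a" where
  "op_app T x = (THE y. (x, y) \<in> T)"

definition densely_defined :: "'a::complex_hilbert_space graph \<Rightarrow> bool" where
  "densely_defined T \<longleftrightarrow> linear_operator T \<and> closure (Domain T) = UNIV"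

text \<open>The graph of the adjoint; it is single-valued when \<open>T\<close> is densely defined.\<close>

definition op_adj :: "'a::complex_hilbert_space graph \<Rightarrow> 'a graph" where
  "op_adj T = {(y, z). \<forall>(x, w) \<in> T. cinner w y = cinner x z}"

definition op_comp :: "'a graph \<Rightarrow> 'a graph \<Rightarrow> 'a graph" where
  "op_comp S T = T O S"

definition hyponormal :: "'a::complex_hilbert_space graph \<Rightarrow> bool" where
  "hyponormal T \<longleftrightarrow> densely_defined T \<and> Domain T \<subseteq> Domain (op_adj T) \<and>
     (\<forall>x \<in> Domain T. norm (op_app (op_adj T) x) \<le> norm (op_app T x))"

definition op_Re :: "'a::complex_hilbert_space graph \<Rightarrow> 'a graph" where
  "op_Re T = {(x, (1 / 2) *\<^sub>C (op_app T x + op_app (op_adj T) x)) | x.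
                x \<in> Domain T \<inter> Domain (op_adj T)}"

definition positive_selfadjoint :: "'a::complex_hilbert_space graph \<Rightarrow> bool" where
  "positive_selfadjoint T \<longleftrightarrow> densely_defined T \<and> op_adj T = T \<and>
     (\<forall>x \<in> Domain T. cinner (op_app T x) x \<in> \<real> \<and> 0 \<le> Re (cinner (op_app T x) x))"

text \<open>Only meaningful for positive self-adjoint \<open>T\<close>, where the square root exists and is unique.\<close>

definition op_sqrt :: "'a::complex_hilbert_space graph \<Rightarrow> 'a graph" where
  "op_sqrt T = (THE S. positive_selfadjoint S \<and> op_comp S S = T)"

text \<open>Only meaningful for closed densely defined \<open>T\<close>.\<close>

definition op_abs :: "'a::complex_hilbert_space graph \<Rightarrow> 'a graph" where
  "op_abs T = op_sqrt (op_comp (op_adj T) T)"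

text \<open>The order is a relation between positive self-adjoint operators only, so this is part of
  the definition.\<close>

definition op_le :: "'a::complex_hilbert_space graph \<Rightarrow> 'a graph \<Rightarrow> bool" where
  "op_le T S \<longleftrightarrow> positive_selfadjoint T \<and> positive_selfadjoint S \<and>
     Domain (op_sqrt S) \<subseteq> Domain (op_sqrt T) \<and>
     (\<forall>x \<in> Domain (op_sqrt S). norm (op_app (op_sqrt T) x) \<le> norm (op_app (op_sqrt S) x))"

end

theory Submission
  imports Defs
begin

text \<open>Since \<open>A\<close> is hyponormal, \<open>Re A\<close> is defined on the whole domain of \<open>A\<close>, and the triangle
  inequality gives \<open>\<parallel>Re A x\<parallel> \<le> (\<parallel>A x\<parallel> + \<parallel>A\<^sup>* x\<parallel>) / 2 \<le> \<parallel>A x\<parallel>\<close>. Let \<open>B\<close> be the closure of \<open>Re A\<close>; it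
  is single-valued because \<open>Re A\<close> is symmetric and densely defined. The absolute value of a closed
  operator has the same domain and the same norms as the operator, so \<open>|A|\<close> dominates \<open>|B|\<close> in norm:
  \<open>\<parallel>|B| x\<parallel> \<le> \<parallel>|A| x\<parallel>\<close> on the domain of \<open>|A|\<close>. The claim is the same comparison for the square roots
  of \<open>|A|\<close> and \<open>|B|\<close>, so the theorem is an instance of Heinz's theorem that the square root is
  operator monotone. Lemma \<open>op_abs_mono\<close> states this conclusion for any two closed densely defined
  operators one of which dominates the other in norm.

  The Heinz inequality is obtained from a symmetrization argument of Krein and Lax, not from a
  spectral theorem. Let \<open>S\<close> be positive self-adjoint, \<open>T\<close> symmetric, and \<open>\<parallel>T x\<parallel> \<le> \<parallel>S x\<parallel>\<close> on the domain
  of \<open>S\<close>. For \<open>e > 0\<close> the operator \<open>L = (S + e)\<^sup>-\<^sup>1 T\<close> is a contraction for the norm \<open>\<parallel>(S + e) x\<parallel>\<close> and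
  symmetric for the weaker inner product \<open>[x, y] = \<langle>(S + e) x, y\<rangle>\<close>. By the Cauchy-Schwarz inequality
  the bounded sequence \<open>[L\<^sup>n x, L\<^sup>n x]\<close> is logarithmically convex, so it does not increase at the first
  step. Hence \<open>\<langle>T x, x\<rangle> = [L x, x] \<le> [x, x]\<close>, and \<open>e\<close> tends to \<open>0\<close> (lemma \<open>heinz_inequality\<close>).

  Existence and uniqueness of square roots of unbounded positive self-adjoint operators come from the
  same tools. Two square roots of one operator have the same quadratic form, by the Heinz
  inequality used in both directions, and are therefore equal. For existence, let \<open>R = (1 + P)\<^sup>-\<^sup>1\<close>,
  which is bounded with \<open>0 \<le> R \<le> 1\<close>; if \<open>U\<close> and \<open>V\<close> are the bounded positive square roots of \<open>R\<close> and
  \<open>1 - R\<close>, then \<open>{(U x, V x)}\<close> is the graph of the square root of \<open>P\<close>.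

  All of this is done for graphs over the real inner product. For a graph that is closed under complex
  scalars the real and the complex adjoint agree, and a square root of a complex linear operator is
  complex linear because it is unique.\<close>

instance complex_hilbert_space \<subseteq> banach ..

section \<open>Orthogonal projection\<close>

lemma inner_self_le_zero_iff: "inner x x \<le> 0 \<longleftrightarrow> x = 0"
  using inner_gt_zero_iff[of x] by (auto simp del: inner_gt_zero_iff)

text \<open>The parallelogram law makes a minimizing sequence for the distance from \<open>h\<close> to \<open>M\<close> Cauchy, and
  the first-order condition at the minimum is orthogonality.\<close>

lemma closed_subspace_projection:
  fixes M :: "'a::{real_inner,banach} set"
  assumes "subspace M" "closed M"
  shows "\<exists>m\<in>M. \<forall>k\<in>M. inner (h - m) k = 0"
proof -
  define d where "d = (INF m\<in>M. (norm (h - m))\<^sup>2)"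
  have bdd: "bdd_below ((\<lambda>m. (norm (h - m))\<^sup>2) ` M)"
    by (rule bdd_belowI[of _ 0]) auto
  have ne: "M \<noteq> {}" using assms(1) subspace_0 by blast
  have d_le: "d \<le> (norm (h - m))\<^sup>2" if "m \<in> M" for m
    unfolding d_def using bdd that by (rule cINF_lower)
  have "\<exists>m\<in>M. (norm (h - m))\<^sup>2 < d + 1 / Suc n" for n
    using cINF_less_iff[OF ne bdd, of "d + 1 / Suc n"] by (simp add: d_def)
  then obtain s where s: "\<And>n. s n \<in> M" "\<And>n. (norm (h - s n))\<^sup>2 < d + 1 / Suc n"
    by metis
  have dist_s: "(norm (s i - s j))\<^sup>2 \<le> 2 / Suc i + 2 / Suc j" for i j
  proof -
    have "(1/2) *\<^sub>R (s i + s j) \<in> M"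
      using s(1) assms(1) by (simp add: subspace_add subspace_scale)
    then have "d \<le> (norm (h - (1/2) *\<^sub>R (s i + s j)))\<^sup>2" by (rule d_le)
    moreover have "(norm (s i - s j))\<^sup>2 = 2 * (norm (h - s i))\<^sup>2 + 2 * (norm (h - s j))\<^sup>2
        - 4 * (norm (h - (1/2) *\<^sub>R (s i + s j)))\<^sup>2"
      by (simp add: power2_norm_eq_inner inner_diff_left inner_diff_right inner_add_left
          inner_add_right inner_commute algebra_simps)
    moreover have "2 / Suc i = 2 * (1 / Suc i)" "2 / Suc j = 2 * (1 / Suc j)" by simp_all
    ultimately show ?thesis using s(2)[of i] s(2)[of j] by linarith
  qed
  have "Cauchy s"
  proof (rule metric_CauchyI)
    fix e :: real assume "e > 0"
    then obtain N where N: "inverse (real (Suc N)) < e\<^sup>2 / 4"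
      using reals_Archimedean[of "e\<^sup>2 / 4"] by auto
    have "dist (s i) (s j) < e" if "i \<ge> N" "j \<ge> N" for i j
    proof -
      have "2 / Suc i \<le> 2 * inverse (real (Suc N))" "2 / Suc j \<le> 2 * inverse (real (Suc N))"
        using that by (auto simp: field_simps)
      then have "(norm (s i - s j))\<^sup>2 < e\<^sup>2" using dist_s[of i j] N by linarith
      then show ?thesis using \<open>e > 0\<close>
        by (simp add: dist_norm power_less_imp_less_base)
    qed
    then show "\<exists>N. \<forall>m\<ge>N. \<forall>n\<ge>N. dist (s m) (s n) < e" by blast
  qed
  then obtain m where m: "s \<longlonglongrightarrow> m" using Cauchy_convergent_iff convergent_def by blast
  have mM: "m \<in> M" using closed_sequentially[OF assms(2)] s(1) m by blast
  have "(\<lambda>n. (norm (h - s n))\<^sup>2) \<longlonglongrightarrow> (norm (h - m))\<^sup>2"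
    by (intro tendsto_intros m)
  moreover have "(\<lambda>n. d + 1 / Suc n) \<longlonglongrightarrow> d + 0"
    by (intro tendsto_add tendsto_const LIMSEQ_Suc[OF lim_1_over_n])
  ultimately have m_min: "(norm (h - m))\<^sup>2 \<le> d"
    using s(2) by (intro LIMSEQ_le[of _ _ "\<lambda>n. d + 1 / Suc n"]) (auto intro: less_imp_le)
  have "inner (h - m) k = 0" if k: "k \<in> M" for k
  proof (cases "k = 0")
    case False
    \<comment> \<open>The minimizer of the distance from \<open>h\<close> to the line through \<open>m\<close> in direction \<open>k\<close>.\<close>
    define t where "t = inner (h - m) k / inner k k"
    have "m + t *\<^sub>R k \<in> M" using mM k assms(1) by (simp add: subspace_add subspace_scale)
    then have "(norm (h - m))\<^sup>2 \<le> (norm (h - (m + t *\<^sub>R k)))\<^sup>2"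
      using d_le m_min order.trans by blast
    also have "h - (m + t *\<^sub>R k) = (h - m) - t *\<^sub>R k" by simp
    also have "(norm ((h - m) - t *\<^sub>R k))\<^sup>2
        = (norm (h - m))\<^sup>2 - 2 * t * inner (h - m) k + t\<^sup>2 * inner k k"
      unfolding power2_norm_eq_inner
      by (simp add: inner_diff_left[of _ "t *\<^sub>R k"] inner_diff_right[of _ _ "t *\<^sub>R k"]
          inner_commute power2_eq_square)
    also have "\<dots> = (norm (h - m))\<^sup>2 - (inner (h - m) k)\<^sup>2 / inner k k"
      using False by (simp add: t_def power2_eq_square field_simps)
    finally have "(inner (h - m) k)\<^sup>2 / inner k k \<le> 0" by simp
    moreover have "0 < inner k k" using False by simp
    ultimately show ?thesis by (auto simp: divide_le_0_iff)
  qed simp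
  then show ?thesis using mM by blast
qed

lemma subspace_closure:
  fixes S :: "'a::real_normed_vector set"
  assumes "subspace S" shows "subspace (closure S)"
  unfolding subspace_def
proof (intro conjI ballI allI)
  show "0 \<in> closure S" using subspace_0[OF assms] closure_subset by blast
next
  fix x y assume "x \<in> closure S" "y \<in> closure S"
  then obtain f g where "\<And>n. f n \<in> S" "f \<longlonglongrightarrow> x" "\<And>n. g n \<in> S" "g \<longlonglongrightarrow> y"
    by (auto simp: closure_sequential)
  then have "\<And>n. f n + g n \<in> S" "(\<lambda>n. f n + g n) \<longlonglongrightarrow> x + y"
    using assms by (auto intro: subspace_add tendsto_add)
  then show "x + y \<in> closure S" unfolding closure_sequential
    by (intro exI[of _ "\<lambda>n. f n + g n"]) auto
next
  fix c :: real and x assume "x \<in> closure S"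
  then obtain f where "\<And>n. f n \<in> S" "f \<longlonglongrightarrow> x"
    by (auto simp: closure_sequential)
  then have "\<And>n. c *\<^sub>R f n \<in> S" "(\<lambda>n. c *\<^sub>R f n) \<longlonglongrightarrow> c *\<^sub>R x"
    using assms by (auto intro: subspace_scale tendsto_intros)
  then show "c *\<^sub>R x \<in> closure S" unfolding closure_sequential
    by (intro exI[of _ "\<lambda>n. c *\<^sub>R f n"]) auto
qed

text \<open>For \<open>p\<close> in \<open>M\<close>, the difference of \<open>p\<close> and its projection to the closure of \<open>C\<close> lies again
  in \<open>M\<close> and is orthogonal to \<open>C\<close>.\<close>

lemma subset_closure_of_trivial_complement:
  fixes C M :: "'a::{real_inner,banach} set"
  assumes "subspace C" "subspace M" "closed M" "C \<subseteq> M"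
    and triv: "\<And>p. p \<in> M \<Longrightarrow> (\<And>c. c \<in> C \<Longrightarrow> inner c p = 0) \<Longrightarrow> p = 0"
  shows "M \<subseteq> closure C"
proof
  fix p assume p: "p \<in> M"
  obtain m where m: "m \<in> closure C" "\<forall>k\<in>closure C. inner (p - m) k = 0"
    using closed_subspace_projection[of "closure C" p] subspace_closure[OF assms(1)] by auto
  have "m \<in> M" using m(1) closure_minimal[OF assms(4,3)] by blast
  then have "p - m \<in> M" using p assms(2) by (simp add: subspace_diff)
  moreover have "inner c (p - m) = 0" if "c \<in> C" for c
    using m(2) that closure_subset by (metis inner_commute subsetD)
  ultimately have "p - m = 0" by (rule triv)
  then show "p \<in> closure C" using m(1) by simp
qed

lemma dense_subspace_iff:
  fixes D :: "'a::{real_inner,banach} set"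
  assumes "subspace D"
  shows "closure D = UNIV \<longleftrightarrow> (\<forall>z. (\<forall>x\<in>D. inner x z = 0) \<longrightarrow> z = 0)"
proof
  assume dense: "closure D = UNIV"
  show "\<forall>z. (\<forall>x\<in>D. inner x z = 0) \<longrightarrow> z = 0"
  proof (intro allI impI)
    fix z assume z: "\<forall>x\<in>D. inner x z = 0"
    have "closed {x. inner x z = 0}"
      by (intro closed_Collect_eq continuous_intros)
    then have "closure D \<subseteq> {x. inner x z = 0}" using z by (intro closure_minimal) auto
    then have "z \<in> {x. inner x z = 0}" unfolding dense by (rule subsetD) simp
    then show "z = 0" by simp
  qed
next
  assume "\<forall>z. (\<forall>x\<in>D. inner x z = 0) \<longrightarrow> z = 0"
  then show "closure D = UNIV"
    using subset_closure_of_trivial_complement[of D UNIV, OF assms subspace_UNIV closed_UNIV]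
    by (meson UNIV_I subset_UNIV subset_antisym)
qed

section \<open>Graphs and adjoints in the real inner product\<close>

text \<open>The adjoint for the real inner product, which is the real part of the complex one. It agrees
  with the complex adjoint on complex linear graphs, see \<open>op_adj_eq_adj\<close> below.\<close>

definition adj :: "'a::real_inner graph \<Rightarrow> 'a graph" where
  "adj T = {(y, z). \<forall>(x, w) \<in> T. inner w y = inner x z}"

lemma adjI: "(\<And>x w. (x, w) \<in> T \<Longrightarrow> inner w y = inner x z) \<Longrightarrow> (y, z) \<in> adj T"
  by (auto simp: adj_def)

lemma adjD: "(y, z) \<in> adj T \<Longrightarrow> (x, w) \<in> T \<Longrightarrow> inner w y = inner x z"
  by (auto simp: adj_def)

lemma subspace_adj: "subspace (adj T)"
  unfolding subspace_def adj_def
  by (fastforce simp: zero_prod_def inner_add_right)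

lemma closed_adj: "closed (adj T)"
proof -
  have "adj T = (\<Inter>p\<in>T. {q. inner (snd p) (fst q) = inner (fst p) (snd q)})"
    by (fastforce simp: adj_def)
  also have "closed \<dots>"
    by (intro closed_INT ballI closed_Collect_eq continuous_intros)
  finally show ?thesis .
qed

lemma subspace_Domain: "subspace T \<Longrightarrow> subspace (Domain T)"
  by (simp add: Domain_fst linear_subspace_image linear_fst)

lemma single_valued_iff:
  fixes T :: "'a::real_vector graph"
  assumes "subspace T" shows "single_valued T \<longleftrightarrow> (\<forall>z. (0, z) \<in> T \<longrightarrow> z = 0)"
proof
  assume "single_valued T"
  moreover have "(0, 0) \<in> T" using subspace_0[OF assms] by (simp add: zero_prod_def)
  ultimately show "\<forall>z. (0, z) \<in> T \<longrightarrow> z = 0" by (auto simp: single_valued_def)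
next
  assume *: "\<forall>z. (0, z) \<in> T \<longrightarrow> z = 0"
  show "single_valued T"
  proof (rule single_valuedI)
    fix x y z assume "(x, y) \<in> T" "(x, z) \<in> T"
    then have "(0, y - z) \<in> T" using subspace_diff[OF assms] by fastforce
    then show "y = z" using * by auto
  qed
qed

lemma graph_add: "subspace T \<Longrightarrow> (x, y) \<in> T \<Longrightarrow> (x', y') \<in> T \<Longrightarrow> (x + x', y + y') \<in> T"
  using subspace_add by fastforce

lemma graph_diff: "subspace T \<Longrightarrow> (x, y) \<in> T \<Longrightarrow> (x', y') \<in> T \<Longrightarrow> (x - x', y - y') \<in> T"
  using subspace_diff by fastforce

lemma graph_scale: "subspace T \<Longrightarrow> (x, y) \<in> T \<Longrightarrow> (c *\<^sub>R x, c *\<^sub>R y) \<in> T"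
  using subspace_scale by fastforce

lemma single_valued_adj:
  fixes T :: "'a::{real_inner,banach} graph"
  assumes "subspace T" "closure (Domain T) = UNIV"
  shows "single_valued (adj T)"
proof (subst single_valued_iff[OF subspace_adj], intro allI impI)
  fix z assume z: "(0, z) \<in> adj T"
  have "\<forall>x\<in>Domain T. inner x z = 0" using adjD[OF z] by fastforce
  then show "z = 0"
    using iffD1[OF dense_subspace_iff[OF subspace_Domain[OF assms(1)]] assms(2)] by simp
qed

text \<open>A norm comparison passes from a core to the whole domain: applied to differences of elements of
  \<open>C\<close>, the comparison makes the values of \<open>T\<close> along a convergent sequence in \<open>C\<close> Cauchy, and \<open>T\<close> is
  closed.\<close>

lemma dominated_on_closure:
  fixes T C :: "'a::{real_inner,banach} graph"
  assumes T: "subspace T" "single_valued T" "closed T" and C: "subspace C"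
    and dom: "\<And>x y. (x, y) \<in> C \<Longrightarrow> \<exists>w. (x, w) \<in> T \<and> norm w \<le> norm y"
    and xy: "(x, y) \<in> closure C"
  shows "\<exists>w. (x, w) \<in> T \<and> norm w \<le> norm y"
proof -
  obtain s where s: "\<And>n. s n \<in> C" "s \<longlonglongrightarrow> (x, y)"
    using xy by (auto simp: closure_sequential)
  define f g where "f n = fst (s n)" and "g n = snd (s n)" for n
  have fg: "(f n, g n) \<in> C" for n using s(1) by (simp add: f_def g_def)
  have lims: "f \<longlonglongrightarrow> x" "g \<longlonglongrightarrow> y"
    using tendsto_fst[OF s(2)] tendsto_snd[OF s(2)] by (simp_all add: f_def[abs_def] g_def[abs_def])
  have "\<forall>n. \<exists>v. (f n, v) \<in> T \<and> norm v \<le> norm (g n)" using dom fg by blast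
  then obtain w where "\<forall>n. (f n, w n) \<in> T \<and> norm (w n) \<le> norm (g n)"
    by (rule choice[THEN exE])
  then have w: "(f n, w n) \<in> T" "norm (w n) \<le> norm (g n)" for n by auto
  have "norm (w m - w n) \<le> norm (g m - g n)" for m n
  proof -
    obtain v where v: "(f m - f n, v) \<in> T" "norm v \<le> norm (g m - g n)"
      using dom[OF graph_diff[OF C fg fg]] by blast
    have "w m - w n = v"
      using graph_diff[OF T(1) w(1) w(1)] v(1) T(2) by (auto dest: single_valuedD)
    then show ?thesis using v(2) by simp
  qed
  then have w_g: "dist (w m) (w n) \<le> dist (g m) (g n)" for m n by (simp add: dist_norm)
  have "Cauchy w"
  proof (rule metric_CauchyI)
    fix e :: real assume "e > 0"
    then obtain N where "\<forall>m\<ge>N. \<forall>n\<ge>N. dist (g m) (g n) < e"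
      using metric_CauchyD[OF LIMSEQ_imp_Cauchy[OF lims(2)]] by blast
    then show "\<exists>N. \<forall>m\<ge>N. \<forall>n\<ge>N. dist (w m) (w n) < e"
      using order.strict_trans1[OF w_g] by blast
  qed
  then obtain v where v: "w \<longlonglongrightarrow> v" using Cauchy_convergent_iff convergent_def by blast
  have "(\<lambda>n. (f n, w n)) \<longlonglongrightarrow> (x, v)" using lims(1) v by (rule tendsto_Pair)
  then have "(x, v) \<in> T" using closed_sequentially[OF T(3), of "\<lambda>n. (f n, w n)"] w(1) by simp
  moreover have "norm v \<le> norm y"
    by (rule LIMSEQ_le[OF tendsto_norm[OF v] tendsto_norm[OF lims(2)]]) (use w(2) in auto)
  ultimately show ?thesis by blast
qed

section \<open>Positive self-adjoint operators\<close>

text \<open>As an adjoint, the graph of \<open>T\<close> is a closed subspace; density of the domain then amounts to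
  single-valuedness of \<open>T = adj T\<close> (lemma \<open>pos_sa_dense\<close>).\<close>

definition pos_sa :: "'a::real_inner graph \<Rightarrow> bool" where
  "pos_sa T \<longleftrightarrow> single_valued T \<and> adj T = T \<and> (\<forall>(x, y) \<in> T. 0 \<le> inner y x)"

lemma pos_saD:
  assumes "pos_sa T"
  shows pos_sa_single_valued: "single_valued T" and pos_sa_adj: "adj T = T"
    and pos_sa_nonneg: "\<And>x y. (x, y) \<in> T \<Longrightarrow> 0 \<le> inner y x"
    and pos_sa_subspace: "subspace T" and pos_sa_closed: "closed T"
    and pos_sa_sym: "\<And>x y x' y'. (x, y) \<in> T \<Longrightarrow> (x', y') \<in> T \<Longrightarrow> inner y x' = inner x y'"
proof -
  show sv: "single_valued T" and a: "adj T = T" using assms by (auto simp: pos_sa_def)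
  show "\<And>x y. (x, y) \<in> T \<Longrightarrow> 0 \<le> inner y x" using assms by (auto simp: pos_sa_def)
  show "subspace T" using a subspace_adj by metis
  show "closed T" using a closed_adj by metis
  show "\<And>x y x' y'. (x, y) \<in> T \<Longrightarrow> (x', y') \<in> T \<Longrightarrow> inner y x' = inner x y'"
    using a adjD by metis
qed

text \<open>A vector \<open>z\<close> orthogonal to the domain gives \<open>(0, z) \<in> adj T = T\<close>.\<close>

lemma pos_sa_dense:
  fixes T :: "'a::{real_inner,banach} graph"
  assumes "pos_sa T" shows "closure (Domain T) = UNIV"
proof -
  note T = pos_saD[OF assms]
  have "z = 0" if "\<forall>x\<in>Domain T. inner x z = 0" for z
  proof -
    have "(0, z) \<in> adj T" using that by (intro adjI) auto
    then show ?thesis using T(1,2) single_valued_iff[OF T(4)] by simp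
  qed
  then show ?thesis by (simp add: dense_subspace_iff[OF subspace_Domain[OF T(4)]])
qed

text \<open>A symmetric \<open>T\<close> with \<open>1 + T\<close> onto is self-adjoint: if \<open>(y, z) \<in> adj T\<close> and \<open>u + T u = y + z\<close>,
  then \<open>y - u\<close> is orthogonal to the range of \<open>1 + T\<close>, so \<open>y = u\<close> and \<open>z = T u\<close>.\<close>

lemma pos_saI:
  fixes T :: "'a::{real_inner,banach} graph"
  assumes sub: "subspace T" and sv: "single_valued T" and sym: "T \<subseteq> adj T"
    and pos: "\<And>x y. (x, y) \<in> T \<Longrightarrow> 0 \<le> inner y x"
    and onto: "\<And>h. \<exists>x y. (x, y) \<in> T \<and> x + y = h"
  shows "pos_sa T"
proof -
  have "(y, z) \<in> T" if yz: "(y, z) \<in> adj T" for y z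
  proof -
    obtain u v where u: "(u, v) \<in> T" "u + v = y + z" using onto by blast
    obtain p q where p: "(p, q) \<in> T" "p + q = y - u" using onto by blast
    have "inner q y = inner p z" "inner q u = inner p v"
      using adjD[OF yz p(1)] adjD[of u v T, OF _ p(1)] u(1) sym by auto
    moreover have "z - v = - (y - u)" using u(2) by (simp add: algebra_simps)
    ultimately have "inner q (y - u) = - inner p (y - u)"
      by (metis inner_diff_right inner_minus_right)
    then have "inner (p + q) (y - u) = 0" by (simp add: inner_add_left)
    then have "y - u = 0" using p(2) by simp
    then show ?thesis using u by (simp add: algebra_simps)
  qed
  then show ?thesis using assms unfolding pos_sa_def by fast
qed

text \<open>The range of \<open>S + e\<close> is closed, as \<open>S + e\<close> is bounded below on the graph, and a vector
  orthogonal to it lies in the kernel of \<open>adj S + e = S + e\<close>.\<close>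

lemma pos_sa_shift_onto:
  fixes S :: "'a::{real_inner,banach} graph"
  assumes S: "pos_sa S" and e: "e > 0"
  shows "\<exists>x y. (x, y) \<in> S \<and> y + e *\<^sub>R x = h"
proof -
  note S' = pos_saD[OF S]
  define f where "f p = snd p + e *\<^sub>R fst p" for p :: "'a \<times> 'a"
  have f: "bounded_linear f" unfolding f_def
    by (intro bounded_linear_intros)
  \<comment> \<open>\<open>f (x, S x) = (S + e) x\<close> is bounded below by \<open>c\<close> on the graph, as \<open>\<langle>S x, x\<rangle> \<ge> 0\<close>.\<close>
  define c where "c = min 1 e"
  have c: "0 < c" "c\<^sup>2 \<le> 1" "c\<^sup>2 \<le> e\<^sup>2"
    using e by (auto simp: c_def power_le_one power_mono)
  have "c * norm p \<le> norm (f p)" if "p \<in> S" for p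
  proof -
    obtain x y where p: "p = (x, y)" by force
    have "(c * norm p)\<^sup>2 = c\<^sup>2 * inner x x + c\<^sup>2 * inner y y"
      by (simp add: p norm_Pair power_mult_distrib power2_norm_eq_inner algebra_simps)
    also have "\<dots> \<le> e\<^sup>2 * inner x x + 1 * inner y y"
      using c by (intro add_mono mult_right_mono) auto
    also have "\<dots> \<le> e\<^sup>2 * inner x x + inner y y + 2 * e * inner y x"
      using S'(3)[of x y] that e by (simp add: p)
    also have "\<dots> = (norm (f p))\<^sup>2"
      unfolding power2_norm_eq_inner
      by (simp add: f_def p inner_add_left inner_add_right inner_commute power2_eq_square)
    finally show ?thesis by (rule power2_le_imp_le) simp
  qed
  then have "complete (f ` S)"
    by (intro complete_isometric_image[OF c(1) S'(4) f])
      (use S'(5) complete_eq_closed in auto)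
  then have "closed (f ` S)" by (rule complete_imp_closed)
  moreover have subf: "subspace (f ` S)"
    using S'(4) f by (simp add: linear_subspace_image bounded_linear.linear)
  ultimately obtain m where m: "m \<in> f ` S" "\<forall>k\<in>f ` S. inner (h - m) k = 0"
    using closed_subspace_projection by blast
  have "(h - m, - e *\<^sub>R (h - m)) \<in> adj S"
  proof (rule adjI)
    fix x w assume "(x, w) \<in> S"
    then have "inner (h - m) (f (x, w)) = 0" using m(2) by blast
    then show "inner w (h - m) = inner x (- e *\<^sub>R (h - m))"
      by (simp add: f_def inner_add_right inner_commute)
  qed
  then have "0 \<le> inner (- e *\<^sub>R (h - m)) (h - m)" using S'(2) S'(3)[of "h - m" "- e *\<^sub>R (h - m)"] by simp
  then have "inner (h - m) (h - m) \<le> 0" using e by (simp add: mult_le_0_iff)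
  then have "h - m = 0" by (simp only: inner_self_le_zero_iff)
  then obtain p where "p \<in> S" "h = f p" using m(1) by auto
  then show ?thesis by (intro exI[of _ "fst p"] exI[of _ "snd p"]) (simp add: f_def)
qed

section \<open>Von Neumann's theorem\<close>

text \<open>The projection \<open>(x, y)\<close> of \<open>(h, 0)\<close> to the graph of \<open>T\<close> leaves a remainder \<open>(h - x, - y)\<close>
  orthogonal to the graph, which says that \<open>h - x = T\<^sup>* y = T\<^sup>* T x\<close>.\<close>

lemma one_plus_adj_comp_onto:
  fixes T :: "'a::{real_inner,banach} graph"
  assumes "subspace T" "closed T"
  shows "\<exists>x z. (x, z) \<in> T O adj T \<and> x + z = h"
proof -
  obtain x y where xy: "(x, y) \<in> T" "\<forall>k\<in>T. inner ((h, 0) - (x, y)) k = 0"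
    using closed_subspace_projection[OF assms, of "(h, 0)"] by auto
  have "(y, h - x) \<in> adj T"
  proof (rule adjI)
    fix u w assume "(u, w) \<in> T"
    then have "inner (h - x) u - inner y w = 0" using xy(2) by fastforce
    then show "inner w y = inner u (h - x)" by (simp add: inner_commute)
  qed
  then show ?thesis using xy(1) by (intro exI[of _ x] exI[of _ "h - x"]) auto
qed

lemma adj_comp_pos_sa:
  fixes T :: "'a::{real_inner,banach} graph"
  assumes T: "subspace T" "single_valued T" "closed T" "closure (Domain T) = UNIV"
  shows "pos_sa (T O adj T)"
proof (rule pos_saI)
  show "subspace (T O adj T)"
    unfolding subspace_def
  proof (intro conjI ballI allI)
    show "0 \<in> T O adj T"
      using subspace_0[OF T(1)] subspace_0[OF subspace_adj[of T]] by (auto simp: zero_prod_def)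
  next
    fix p q assume "p \<in> T O adj T" "q \<in> T O adj T"
    then show "p + q \<in> T O adj T"
      using graph_add[OF T(1)] graph_add[OF subspace_adj[of T]] by fastforce
  next
    fix c :: real and p assume "p \<in> T O adj T"
    then show "c *\<^sub>R p \<in> T O adj T"
      using graph_scale[OF T(1)] graph_scale[OF subspace_adj[of T]] by fastforce
  qed
  show "single_valued (T O adj T)"
    using T single_valued_adj single_valued_relcomp by blast
  show "T O adj T \<subseteq> adj (T O adj T)"
  proof clarify
    fix x y z assume x: "(x, y) \<in> T" "(y, z) \<in> adj T"
    show "(x, z) \<in> adj (T O adj T)"
    proof (rule adjI, clarify)
      fix x' y' z' assume x': "(x', y') \<in> T" "(y', z') \<in> adj T"
      show "inner z' x = inner x' z"
        using adjD[OF x(2) x'(1)] adjD[OF x'(2) x(1)] by (simp add: inner_commute)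
    qed
  qed
  show "0 \<le> inner z x" if "(x, z) \<in> T O adj T" for x z
  proof -
    obtain y where "(x, y) \<in> T" "(y, z) \<in> adj T" using \<open>(x, z) \<in> T O adj T\<close> by (rule relcompEpair)
    then have "inner z x = inner y y" using adjD by (metis inner_commute)
    then show ?thesis by simp
  qed
  show "\<exists>x y. (x, y) \<in> T O adj T \<and> x + y = h" for h
    using one_plus_adj_comp_onto[OF T(1,3)] .
qed

text \<open>The domain of \<open>T\<^sup>*T\<close> is a core for \<open>T\<close>: a pair in \<open>T\<close> orthogonal to the restriction of \<open>T\<close> to
  that domain has its first component orthogonal to the range of \<open>1 + T\<^sup>*T\<close>.\<close>

lemma adj_comp_core:
  fixes T :: "'a::{real_inner,banach} graph"
  assumes T: "subspace T" "single_valued T" "closed T"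
  shows "subspace {(x, y) \<in> T. y \<in> Domain (adj T)}"
    and "T \<subseteq> closure {(x, y) \<in> T. y \<in> Domain (adj T)}"
proof -
  let ?C = "{(x, y) \<in> T. y \<in> Domain (adj T)}"
  have D: "subspace (Domain (adj T))" by (rule subspace_Domain[OF subspace_adj])
  have "?C = T \<inter> snd -` Domain (adj T)" by auto
  then show C: "subspace ?C"
    using T(1) D by (simp add: subspace_inter linear_subspace_vimage linear_snd)
  show "T \<subseteq> closure ?C"
  proof (rule subset_closure_of_trivial_complement[OF C T(1,3)])
    fix p assume p: "p \<in> T" "\<And>c. c \<in> ?C \<Longrightarrow> inner c p = 0"
    obtain x y where xy: "p = (x, y)" by force
    obtain u z where uz: "(u, z) \<in> T O adj T" "u + z = x"
      using one_plus_adj_comp_onto[OF T(1,3)] by blast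
    then obtain v where v: "(u, v) \<in> T" "(v, z) \<in> adj T" by auto
    have "inner u x + inner v y = 0" using p(2)[of "(u, v)"] v xy by auto
    moreover have "inner v y = inner x z" using adjD[OF v(2)] p(1) xy by (metis inner_commute)
    ultimately have "inner (u + z) x = 0" by (simp add: inner_add_left inner_commute[of z])
    then have "x = 0" using uz by simp
    moreover have "(0, 0) \<in> T" using subspace_0[OF T(1)] by (simp add: zero_prod_def)
    ultimately show "p = 0" using p(1) xy T(2) by (auto simp: single_valued_def zero_prod_def)
  qed auto
qed

text \<open>On the domain of \<open>S\<^sup>*S\<close>, which is a core for \<open>S\<close>, both \<open>\<parallel>S x\<parallel>\<^sup>2\<close> and \<open>\<parallel>T x\<parallel>\<^sup>2\<close> equal
  \<open>\<langle>S\<^sup>*S x, x\<rangle>\<close>. This compares an operator with its absolute value, and two square roots of one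
  operator with each other.\<close>

lemma same_adj_comp_dominated:
  fixes S T :: "'a::{real_inner,banach} graph"
  assumes S: "subspace S" "single_valued S" "closed S"
    and T: "subspace T" "single_valued T" "closed T"
    and dom: "S O adj S \<subseteq> T O adj T" and xy: "(x, y) \<in> S"
  shows "\<exists>w. (x, w) \<in> T \<and> norm w \<le> norm y"
proof (rule dominated_on_closure[OF T adj_comp_core(1)[OF S]])
  show "(x, y) \<in> closure {(x, y) \<in> S. y \<in> Domain (adj S)}"
    using adj_comp_core(2)[OF S] xy by blast
next
  fix x y assume "(x, y) \<in> {(x, y) \<in> S. y \<in> Domain (adj S)}"
  then obtain z where z: "(x, y) \<in> S" "(y, z) \<in> adj S" by auto
  then obtain w where w: "(x, w) \<in> T" "(w, z) \<in> adj T" using dom by blast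
  have "inner y y = inner w w" using adjD[OF z(2,1)] adjD[OF w(2,1)] by simp
  then have "norm w = norm y" by (simp add: norm_eq_sqrt_inner)
  then show "\<exists>w. (x, w) \<in> T \<and> norm w \<le> norm y" using w(1) by auto
qed

section \<open>The Heinz inequality\<close>

text \<open>The ratios of consecutive terms do not decrease, so an increase at the first step would force
  geometric growth.\<close>

lemma log_convex_bounded:
  fixes q :: "nat \<Rightarrow> real"
  assumes nonneg: "\<And>n. 0 \<le> q n" and conv: "\<And>n. (q (Suc n))\<^sup>2 \<le> q n * q (Suc (Suc n))"
    and bound: "\<And>n. q n \<le> C"
  shows "q 1 \<le> q 0"
proof (rule ccontr)
  assume "\<not> q 1 \<le> q 0"
  then have less: "q 0 < q 1" by simp
  have pos: "0 < q 0"
  proof (rule ccontr)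
    assume "\<not> 0 < q 0"
    then have "q 0 = 0" using nonneg[of 0] by simp
    then show False using conv[of 0] less by simp
  qed
  define r where "r = q 1 / q 0"
  have r: "r > 1" using less pos by (simp add: r_def)
  have step: "0 < q n \<and> r * q n \<le> q (Suc n)" for n
  proof (induction n)
    case 0
    then show ?case using pos by (simp add: r_def)
  next
    case (Suc n)
    have "0 < r * q n" using Suc r by simp
    then have pos': "0 < q (Suc n)" using Suc by linarith
    have "(r * q (Suc n)) * q n \<le> q (Suc n) * q (Suc n)"
      using mult_right_mono[of "r * q n" "q (Suc n)" "q (Suc n)"] Suc pos' by (simp add: ac_simps)
    also have "\<dots> \<le> q (Suc (Suc n)) * q n"
      using conv[of n] by (simp add: power2_eq_square ac_simps)
    finally have "r * q (Suc n) \<le> q (Suc (Suc n))" using Suc by simp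
    then show ?case using pos' by simp
  qed
  have grow: "r ^ n * q 0 \<le> q n" for n
  proof (induction n)
    case (Suc n)
    have "r ^ Suc n * q 0 \<le> r * q n" using Suc r by (simp add: mult.assoc mult_left_mono)
    then show ?case using step[of n] by linarith
  qed simp
  obtain n where "C / q 0 < r ^ n" using real_arch_pow[OF r] by blast
  then have "C < r ^ n * q 0" using pos by (simp add: field_simps)
  then show False using grow[of n] bound[of n] by linarith
qed

text \<open>The Krein-Lax argument. A point \<open>x\<close> of the domain of \<open>S\<close> is carried along as the pair
  \<open>p = (x, S x)\<close>, so \<open>a p\<close> stands for \<open>(S + e) x\<close>, \<open>B\<close> for the inner product \<open>\<langle>(S + e) x, y\<rangle>\<close>, and \<open>L\<close>
  for \<open>(S + e)\<^sup>-\<^sup>1 T\<close>. The contraction property of \<open>L\<close> in the norm of \<open>a p\<close> bounds the sequence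
  \<open>B (L\<^sup>n p) (L\<^sup>n p)\<close>, and its symmetry for \<open>B\<close> makes that sequence logarithmically convex.\<close>

lemma heinz_inequality:
  fixes S T :: "'a::{real_inner,banach} graph"
  assumes S: "pos_sa S" and T: "single_valued T" "T \<subseteq> adj T"
    and dom: "\<And>x y. (x, y) \<in> S \<Longrightarrow> \<exists>w. (x, w) \<in> T \<and> norm w \<le> norm y"
    and xy: "(x, y) \<in> S" and xv: "(x, v) \<in> T"
  shows "inner v x \<le> inner y x"
proof -
  note S' = pos_saD[OF S]
  have shifted: "inner v x \<le> inner y x + e * inner x x" if e: "e > 0" for e
  proof -
    define a where "a p = snd p + e *\<^sub>R fst p" for p :: "'a \<times> 'a"
    have norm_a: "norm (snd p) \<le> norm (a p)"
        and a_fst: "e * inner (a p) (fst p) \<le> (norm (a p))\<^sup>2" if "p \<in> S" for p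
    proof -
      have nn: "0 \<le> inner (snd p) (fst p)" using S'(3)[of "fst p" "snd p"] that by simp
      have "(norm (snd p))\<^sup>2 + e * inner (a p) (fst p) + e * inner (snd p) (fst p) = (norm (a p))\<^sup>2"
        unfolding power2_norm_eq_inner
        by (simp add: a_def inner_add_left inner_add_right inner_commute algebra_simps)
      moreover have "0 \<le> e * inner (a p) (fst p)" "0 \<le> e * inner (snd p) (fst p)"
        using nn e by (simp_all add: a_def inner_add_left)
      moreover have "0 \<le> (norm (snd p))\<^sup>2" by simp
      ultimately have "(norm (snd p))\<^sup>2 \<le> (norm (a p))\<^sup>2" "e * inner (a p) (fst p) \<le> (norm (a p))\<^sup>2"
        by linarith+
      then show "norm (snd p) \<le> norm (a p)" "e * inner (a p) (fst p) \<le> (norm (a p))\<^sup>2"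
        by (auto intro: power2_le_imp_le)
    qed
    have "\<exists>q\<in>S. (fst p, a q) \<in> T \<and> norm (a q) \<le> norm (a p)" if p: "p \<in> S" for p
    proof -
      obtain w where w: "(fst p, w) \<in> T" "norm w \<le> norm (snd p)"
        using dom[of "fst p" "snd p"] p by auto
      obtain x' y' where "(x', y') \<in> S" "y' + e *\<^sub>R x' = w"
        using pos_sa_shift_onto[OF S e] by blast
      then show ?thesis using w norm_a[OF p] by (intro bexI[of _ "(x', y')"]) (auto simp: a_def)
    qed
    then obtain L where L: "\<And>p. p \<in> S \<Longrightarrow> L p \<in> S" "\<And>p. p \<in> S \<Longrightarrow> (fst p, a (L p)) \<in> T"
        "\<And>p. p \<in> S \<Longrightarrow> norm (a (L p)) \<le> norm (a p)"
      by metis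
    define B where "B p q = inner (a p) (fst q)" for p q :: "'a \<times> 'a"
    have B_commute: "B p q = B q p" if "p \<in> S" "q \<in> S" for p q
      using S'(6)[of "fst p" "snd p" "fst q" "snd q"] that
      by (simp add: B_def a_def inner_add_left inner_add_right inner_commute)
    have B_L: "B (L p) q = B (L q) p" if "p \<in> S" "q \<in> S" for p q
    proof -
      have "(fst q, a (L q)) \<in> adj T" using L(2) T(2) that by blast
      then have "inner (a (L p)) (fst q) = inner (fst p) (a (L q))"
        using adjD L(2) that by blast
      then show ?thesis by (simp add: B_def inner_commute)
    qed
    have B_ge: "e * inner (fst p) (fst p) \<le> B p p" if "p \<in> S" for p
      using S'(3)[of "fst p" "snd p"] that by (simp add: B_def a_def inner_add_left)
    have B_nonneg: "0 \<le> B p p" if "p \<in> S" for p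
    proof -
      have "0 \<le> e * inner (fst p) (fst p)" using e by simp
      then show ?thesis using B_ge[OF that] by linarith
    qed
    have cs: "(B p q)\<^sup>2 \<le> B p p * B q q" if p: "p \<in> S" and q: "q \<in> S" for p q
    proof (cases "B q q = 0")
      case True
      then have "e * inner (fst q) (fst q) \<le> 0" using B_ge[OF q] by simp
      then have "fst q = 0" using e by (simp add: mult_le_0_iff inner_self_le_zero_iff)
      then show ?thesis by (simp add: B_def)
    next
      case False
      then have pos: "0 < B q q" using B_nonneg[OF q] by simp
      define t where "t = B p q / B q q"
      have "p - t *\<^sub>R q \<in> S" using p q S'(4) by (simp add: subspace_diff subspace_scale)
      then have "0 \<le> B (p - t *\<^sub>R q) (p - t *\<^sub>R q)" by (rule B_nonneg)
      also have "\<dots> = B p p - t * B p q - t * B q p + t * t * B q q"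
        by (simp add: B_def a_def inner_diff_left inner_diff_right inner_add_left algebra_simps)
      also have "\<dots> = B p p - (B p q)\<^sup>2 / B q q"
        using False B_commute[OF p q] by (simp add: t_def power2_eq_square)
      finally show ?thesis using pos by (simp add: field_simps)
    qed
    define p where "p n = (L ^^ n) (x, y)" for n
    have p_Suc: "p (Suc n) = L (p n)" for n by (simp add: p_def)
    have pS: "p n \<in> S" for n by (induction n) (simp_all add: p_Suc L(1), simp add: p_def xy)
    have "norm (a (p n)) \<le> norm (a (p 0))" for n
      by (induction n) (auto simp: p_Suc intro: order.trans L(3) pS)
    then have "e * B (p n) (p n) \<le> (norm (a (p 0)))\<^sup>2" for n
      using a_fst[OF pS[of n]] unfolding B_def
      by (meson norm_ge_zero order_trans power_mono)
    then have "B (p n) (p n) \<le> (norm (a (p 0)))\<^sup>2 / e" for n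
      using e by (simp add: field_simps)
    moreover have "(B (p (Suc n)) (p (Suc n)))\<^sup>2 \<le> B (p n) (p n) * B (p (Suc (Suc n))) (p (Suc (Suc n)))"
      for n
      using cs[OF pS pS, of n "Suc (Suc n)"] B_L[OF pS pS, of n "Suc n"] B_commute[OF pS pS, of n "Suc (Suc n)"]
      by (simp add: p_Suc)
    ultimately have le: "B (p 1) (p 1) \<le> B (p 0) (p 0)"
      using log_convex_bounded[of "\<lambda>n. B (p n) (p n)"] B_nonneg[OF pS] by blast
    have "(B (p 1) (p 0))\<^sup>2 \<le> B (p 1) (p 1) * B (p 0) (p 0)" by (rule cs[OF pS pS])
    also have "\<dots> \<le> (B (p 0) (p 0))\<^sup>2"
      using le B_nonneg[OF pS] by (simp add: power2_eq_square mult_right_mono)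
    finally have "B (p 1) (p 0) \<le> B (p 0) (p 0)"
      using B_nonneg[OF pS] power2_le_imp_le by blast
    moreover have "a (p 1) = v"
      using L(2)[OF xy] xv T(1) by (auto simp: p_def dest: single_valuedD)
    ultimately have "inner v (fst (p 0)) \<le> inner (a (p 0)) (fst (p 0))" by (simp add: B_def)
    then show ?thesis by (simp add: p_def a_def inner_add_left)
  qed
  \<comment> \<open>The summand \<open>1\<close> keeps the denominator positive for \<open>x = 0\<close>.\<close>
  show ?thesis
  proof (rule field_le_epsilon)
    fix e :: real assume e: "e > 0"
    have c: "0 < inner x x + 1" by (simp add: add_nonneg_pos)
    have "e / (inner x x + 1) * inner x x \<le> e" using e c by (simp add: field_simps)
    then show "inner v x \<le> inner y x + e"
      using shifted[of "e / (inner x x + 1)"] e c by simp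
  qed
qed

section \<open>Square roots\<close>

text \<open>Both operators have the same domain and norms, so the Heinz inequality applies in both directions
  and shows that their quadratic forms agree; polarization and density of the domain do the rest.\<close>

lemma pos_sa_square_inject:
  fixes S T :: "'a::{real_inner,banach} graph"
  assumes S: "pos_sa S" and T: "pos_sa T" and eq: "S O S = T O T"
  shows "S = T"
proof -
  have dom: "\<exists>w. (x, w) \<in> T \<and> norm w \<le> norm y"
    if "pos_sa S" "pos_sa T" "S O S = T O T" "(x, y) \<in> S" for S T :: "'a graph" and x y
    using same_adj_comp_dominated[of S T x y] pos_saD[OF that(1)] pos_saD[OF that(2)] that(3,4)
    by simp
  have "S \<subseteq> T" if S: "pos_sa S" and T: "pos_sa T" and eq: "S O S = T O T" for S T :: "'a graph"
  proof clarify
    note S' = pos_saD[OF S] and T' = pos_saD[OF T]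
    have form: "inner w x = inner y x" if "(x, y) \<in> S" "(x, w) \<in> T" for x y w
      using heinz_inequality[OF S T'(1) _ dom[OF S T eq] that]
        heinz_inequality[OF T S'(1) _ dom[OF T S eq[symmetric]] that(2,1)] S'(2) T'(2)
      by (simp add: order_antisym)
    fix x y assume xy: "(x, y) \<in> S"
    obtain w where w: "(x, w) \<in> T" using dom[OF S T eq xy] by blast
    have "inner x' (y - w) = 0" if x': "x' \<in> Domain S" for x'
    proof -
      obtain y' where y': "(x', y') \<in> S" using x' by blast
      obtain w' where w': "(x', w') \<in> T" using dom[OF S T eq y'] by blast
      have "inner (w + w') (x + x') = inner (y + y') (x + x')"
        using form graph_add[OF S'(4) xy y'] graph_add[OF T'(4) w w'] by blast
      then have "inner w x' + inner w' x = inner y x' + inner y' x"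
        using form[OF xy w] form[OF y' w'] by (simp add: inner_add_left inner_add_right)
      moreover have "inner y x' = inner y' x" "inner w x' = inner w' x"
        using S'(6)[OF xy y'] T'(6)[OF w w'] by (simp_all add: inner_commute)
      ultimately show ?thesis by (simp add: inner_diff_right inner_commute)
    qed
    then have "y - w = 0"
      using iffD1[OF dense_subspace_iff[OF subspace_Domain[OF S'(4)]] pos_sa_dense[OF S]] by blast
    then show "(x, y) \<in> T" using w by simp
  qed
  from this[OF S T eq] this[OF T S eq[symmetric]] show ?thesis by blast
qed

text \<open>A fixed point \<open>Y = (X + Y\<^sup>2) / 2\<close> satisfies \<open>(1 - Y)\<^sup>2 = 1 - X\<close>.\<close>

primrec sqrt_iter :: "('a::real_normed_vector \<Rightarrow>\<^sub>L 'a) \<Rightarrow> nat \<Rightarrow> 'a \<Rightarrow>\<^sub>L 'a" where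
  "sqrt_iter X 0 = 0"
| "sqrt_iter X (Suc n) = (1/2) *\<^sub>R (X + (sqrt_iter X n o\<^sub>L sqrt_iter X n))"

text \<open>The same iteration for the number \<open>X = 1\<close>. It majorizes the iteration for every \<open>X\<close> of norm at
  most one, so convergence in operator norm follows even where \<open>1 - X\<close> is not invertible.\<close>

primrec sqrt_iter_bound :: "nat \<Rightarrow> real" where
  "sqrt_iter_bound 0 = 0"
| "sqrt_iter_bound (Suc n) = (1 + (sqrt_iter_bound n)\<^sup>2) / 2"

lemma sqrt_iter_bound_range: "0 \<le> sqrt_iter_bound n \<and> sqrt_iter_bound n \<le> 1"
proof (induction n)
  case (Suc n)
  then have "(sqrt_iter_bound n)\<^sup>2 \<le> 1" by (simp add: power_le_one)
  then show ?case by simp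
qed simp

lemma norm_sqrt_iter:
  assumes "norm X \<le> 1" shows "norm (sqrt_iter X n) \<le> sqrt_iter_bound n"
proof (induction n)
  case (Suc n)
  let ?Y = "sqrt_iter X n" and ?y = "sqrt_iter_bound n"
  have "norm (?Y o\<^sub>L ?Y) \<le> norm ?Y * norm ?Y" by (rule norm_blinfun_compose)
  also have "\<dots> \<le> ?y * ?y" using Suc sqrt_iter_bound_range[of n] by (intro mult_mono) auto
  finally have "norm (X + (?Y o\<^sub>L ?Y)) \<le> 1 + ?y\<^sup>2"
    using assms norm_triangle_ineq[of X "?Y o\<^sub>L ?Y"] by (simp add: power2_eq_square)
  then show ?case by simp
qed simp

text \<open>The increments are controlled through \<open>Y\<^sub>k\<^sup>2 - Y\<^sub>n\<^sup>2 = (Y\<^sub>k - Y\<^sub>n) Y\<^sub>k + Y\<^sub>n (Y\<^sub>k - Y\<^sub>n)\<close>.\<close>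

lemma norm_sqrt_iter_diff:
  assumes X: "norm X \<le> 1" and "n \<le> m"
  shows "norm (sqrt_iter X m - sqrt_iter X n) \<le> sqrt_iter_bound m - sqrt_iter_bound n"
  using \<open>n \<le> m\<close>
proof (induction n arbitrary: m)
  case 0
  then show ?case using norm_sqrt_iter[OF X] by simp
next
  case (Suc n)
  then obtain k where k: "m = Suc k" "n \<le> k" by (cases m) auto
  let ?Y = "sqrt_iter X" and ?y = "sqrt_iter_bound"
  note c = bounded_bilinear_blinfun_compose
  have "?Y m - ?Y (Suc n) = (1/2) *\<^sub>R (((?Y k - ?Y n) o\<^sub>L ?Y k) + (?Y n o\<^sub>L (?Y k - ?Y n)))"
    by (simp add: k bounded_bilinear.diff_left[OF c] bounded_bilinear.diff_right[OF c]
        algebra_simps)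
  also have "norm \<dots> \<le> (norm ((?Y k - ?Y n) o\<^sub>L ?Y k) + norm (?Y n o\<^sub>L (?Y k - ?Y n))) / 2"
    by (simp add: norm_triangle_ineq)
  also have "\<dots> \<le> (norm (?Y k - ?Y n) * norm (?Y k) + norm (?Y n) * norm (?Y k - ?Y n)) / 2"
    by (intro divide_right_mono add_mono norm_blinfun_compose) simp
  also have "\<dots> \<le> ((?y k - ?y n) * ?y k + ?y n * (?y k - ?y n)) / 2"
    using Suc.IH[OF k(2)] norm_sqrt_iter[OF X] sqrt_iter_bound_range order_trans[OF norm_ge_zero Suc.IH[OF k(2)]]
    by (intro divide_right_mono add_mono mult_mono) auto
  also have "\<dots> = ?y m - ?y (Suc n)"
    by (simp add: k power2_eq_square field_simps)
  finally show ?case .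
qed

text \<open>The square root is \<open>Q = 1 - Y\<close> for the limit \<open>Y\<close> of the iteration started from \<open>X = 1 - A\<close>.
  Symmetry and commutation hold for each iterate and pass to the limit; \<open>\<parallel>Y\<parallel> \<le> 1\<close> makes \<open>Q\<close>
  positive and makes a further square root of \<open>Q\<close> available.\<close>

lemma blinfun_sqrt:
  fixes A :: "'a::{real_inner,banach} \<Rightarrow>\<^sub>L 'a"
  assumes A: "norm (id_blinfun - A) \<le> 1" and sym: "\<And>x y. inner (A x) y = inner x (A y)"
  obtains Q :: "'a \<Rightarrow>\<^sub>L 'a" where "\<And>x. Q (Q x) = A x" "\<And>x y. inner (Q x) y = inner x (Q y)"
    "\<And>x. 0 \<le> inner (Q x) x" "norm (id_blinfun - Q) \<le> 1"
    "\<And>Z :: 'a \<Rightarrow>\<^sub>L 'a. \<forall>x. Z (A x) = A (Z x) \<Longrightarrow> \<forall>x. Z (Q x) = Q (Z x)"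
proof -
  define X where "X = id_blinfun - A"
  have X: "norm X \<le> 1" and X_apply: "X x = x - A x" for x
    using A by (simp_all add: X_def blinfun.diff_left)
  let ?Y = "sqrt_iter X" and ?y = sqrt_iter_bound
  have "incseq ?y"
    using norm_sqrt_iter_diff[OF X] order_trans[OF norm_ge_zero] by (fastforce simp: incseq_def)
  then obtain l where "?y \<longlonglongrightarrow> l"
    using incseq_convergent[of ?y 1] sqrt_iter_bound_range by metis
  then have y: "Cauchy ?y" by (rule LIMSEQ_imp_Cauchy)
  have dist_Y: "dist (?Y m) (?Y n) \<le> dist (?y m) (?y n)" for m n
    using norm_sqrt_iter_diff[OF X, of n m] norm_sqrt_iter_diff[OF X, of m n]
    by (cases "n \<le> m") (auto simp: dist_norm norm_minus_commute)
  have "Cauchy ?Y"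
  proof (rule metric_CauchyI)
    fix e :: real assume "e > 0"
    then obtain N where "\<forall>m\<ge>N. \<forall>n\<ge>N. dist (?y m) (?y n) < e"
      using metric_CauchyD[OF y] by blast
    then show "\<exists>N. \<forall>m\<ge>N. \<forall>n\<ge>N. dist (?Y m) (?Y n) < e"
      using order.strict_trans1[OF dist_Y] by blast
  qed
  then obtain Y where Y: "?Y \<longlonglongrightarrow> Y" using Cauchy_convergent_iff convergent_def by blast
  have Yx: "(\<lambda>n. ?Y n x) \<longlonglongrightarrow> Y x" for x
    by (intro tendsto_intros Y)
  have "(\<lambda>n. ?Y (Suc n)) \<longlonglongrightarrow> (1/2) *\<^sub>R (X + (Y o\<^sub>L Y))"
    unfolding sqrt_iter.simps
    by (intro tendsto_intros bounded_bilinear.tendsto[OF bounded_bilinear_blinfun_compose] Y)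
  then have "Y = (1/2) *\<^sub>R (X + (Y o\<^sub>L Y))"
    using LIMSEQ_Suc[OF Y] LIMSEQ_unique by blast
  then have fixpoint: "Y x = (1/2) *\<^sub>R (X x + Y (Y x))" for x
    by (metis blinfun.add_left blinfun.scaleR_left blinfun_apply_blinfun_compose)
  have norm_Y: "norm Y \<le> 1"
  proof (rule LIMSEQ_le_const2[OF tendsto_norm[OF Y]])
    show "\<exists>N. \<forall>n\<ge>N. norm (?Y n) \<le> 1"
      using norm_sqrt_iter[OF X] sqrt_iter_bound_range order_trans by blast
  qed
  have sym_iter: "inner (?Y n x) y = inner x (?Y n y)" for n x y
    by (induction n arbitrary: x y)
      (simp_all add: blinfun.add_left blinfun.scaleR_left X_apply inner_add_left inner_add_right
        inner_diff_left inner_diff_right sym)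
  have sym_Y: "inner (Y x) y = inner x (Y y)" for x y
  proof (rule LIMSEQ_unique)
    show "(\<lambda>n. inner (?Y n x) y) \<longlonglongrightarrow> inner (Y x) y" by (intro tendsto_intros Yx)
    show "(\<lambda>n. inner (?Y n x) y) \<longlonglongrightarrow> inner x (Y y)"
      unfolding sym_iter by (intro tendsto_intros Yx)
  qed
  have comm_Y: "Z (Y x) = Y (Z x)" if Z: "\<And>x. Z (A x) = A (Z x)" for Z :: "'a \<Rightarrow>\<^sub>L 'a" and x
  proof (rule LIMSEQ_unique)
    have comm: "Z (?Y n x) = ?Y n (Z x)" for n x
      by (induction n arbitrary: x)
        (simp_all add: blinfun.add_left blinfun.scaleR_left blinfun.add_right blinfun.scaleR_right
          X_apply blinfun.diff_right Z)
    show "(\<lambda>n. Z (?Y n x)) \<longlonglongrightarrow> Z (Y x)" by (intro tendsto_intros Yx)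
    show "(\<lambda>n. Z (?Y n x)) \<longlonglongrightarrow> Y (Z x)" unfolding comm by (rule Yx)
  qed
  define Q where "Q = id_blinfun - Y"
  have Q: "Q x = x - Y x" for x by (simp add: Q_def blinfun.diff_left)
  show thesis
  proof (rule that)
    show "Q (Q x) = A x" for x
    proof -
      have "2 *\<^sub>R Y x = X x + Y (Y x)" by (subst fixpoint) simp
      then show ?thesis by (simp add: Q blinfun.diff_right X_apply scaleR_2 algebra_simps)
    qed
    show "inner (Q x) y = inner x (Q y)" for x y
      by (simp add: Q inner_diff_left inner_diff_right sym_Y)
    show "0 \<le> inner (Q x) x" for x
    proof -
      have "inner (Y x) x \<le> norm (Y x) * norm x" by (rule norm_cauchy_schwarz)
      also have "\<dots> \<le> norm x * norm x"
        using norm_blinfun[of Y x] mult_right_mono[OF norm_Y norm_ge_zero[of x]]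
        by (intro mult_right_mono) auto
      also have "\<dots> = inner x x" by (simp add: norm_eq_sqrt_inner)
      finally show ?thesis by (simp add: Q inner_diff_left)
    qed
    show "norm (id_blinfun - Q) \<le> 1" using norm_Y by (simp add: Q_def)
    show "\<forall>x. Z (Q x) = Q (Z x)" if "\<forall>x. Z (A x) = A (Z x)" for Z :: "'a \<Rightarrow>\<^sub>L 'a"
      using that by (simp add: Q blinfun.diff_right comm_Y)
  qed
qed

text \<open>\<open>R\<close> is \<open>(1 + P)\<^sup>-\<^sup>1\<close>. Both norm bounds follow from \<open>\<parallel>R h\<parallel>\<^sup>2 \<le> \<langle>h, R h\<rangle>\<close>, which is positivity of \<open>P\<close>
  at \<open>R h\<close>.\<close>

lemma pos_sa_resolvent:
  fixes P :: "'a::{real_inner,banach} graph"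
  assumes P: "pos_sa P"
  obtains R :: "'a \<Rightarrow>\<^sub>L 'a" where "\<And>x y. (x, y) \<in> P \<longleftrightarrow> x = R (x + y)"
    "\<And>x y. inner (R x) y = inner x (R y)" "norm R \<le> 1" "norm (id_blinfun - R) \<le> 1"
proof -
  note P' = pos_saD[OF P]
  have "\<exists>x. (x, h - x) \<in> P" for h
  proof -
    obtain x y where "(x, y) \<in> P" "y + 1 *\<^sub>R x = h"
      using pos_sa_shift_onto[OF P, of 1 h] by auto
    then have "(x, h - x) \<in> P" by auto
    then show ?thesis by blast
  qed
  then obtain r where r: "\<And>h. (r h, h - r h) \<in> P" by metis
  have unique: "x = r (x + y)" if "(x, y) \<in> P" for x y
  proof -
    let ?d = "x - r (x + y)"
    have "(?d, y - (x + y - r (x + y))) \<in> P" by (rule graph_diff[OF P'(4) that r])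
    moreover have "y - (x + y - r (x + y)) = - ?d" by simp
    ultimately have "0 \<le> inner (- ?d) ?d" using P'(3) by metis
    then have "inner ?d ?d \<le> 0" unfolding inner_minus_left by linarith
    then have "?d = 0" by (simp only: inner_self_le_zero_iff)
    then show ?thesis by simp
  qed
  have add: "r (h + k) = r h + r k" for h k
    using unique[OF graph_add[OF P'(4) r[of h] r[of k]]] by (simp add: algebra_simps)
  have scale: "r (c *\<^sub>R h) = c *\<^sub>R r h" for c h
    using unique[OF graph_scale[OF P'(4) r[of h], of c]] by (simp add: algebra_simps)
  have r_le: "(norm (r h))\<^sup>2 \<le> inner h (r h)" for h
    using P'(3)[OF r[of h]] by (simp add: inner_diff_left power2_norm_eq_inner)
  have norm_r: "norm (r h) \<le> norm h" for h
  proof (cases "r h = 0")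
    case False
    have "norm (r h) * norm (r h) \<le> norm h * norm (r h)"
      using r_le[of h] norm_cauchy_schwarz[of h "r h"] by (simp add: power2_eq_square)
    then show ?thesis using False by simp
  qed simp
  have norm_diff: "norm (h - r h) \<le> norm h" for h
  proof (rule power2_le_imp_le)
    have "(norm (h - r h))\<^sup>2 = (norm h)\<^sup>2 - 2 * inner h (r h) + (norm (r h))\<^sup>2"
      unfolding power2_norm_eq_inner by (simp add: inner_diff_left inner_diff_right inner_commute)
    moreover have "0 \<le> (norm (r h))\<^sup>2" by simp
    ultimately show "(norm (h - r h))\<^sup>2 \<le> (norm h)\<^sup>2" using r_le[of h] by linarith
  qed simp
  have bl: "bounded_linear r"
    by (rule bounded_linear_intro[of _ 1]) (simp_all add: add scale norm_r)
  define R where "R = Blinfun r"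
  have R: "R h = r h" for h by (simp add: R_def bounded_linear_Blinfun_apply[OF bl])
  show thesis
  proof (rule that)
    show "(x, y) \<in> P \<longleftrightarrow> x = R (x + y)" for x y
    proof
      assume "x = R (x + y)"
      then show "(x, y) \<in> P" using r[of "x + y"] by (simp add: R)
    qed (simp add: R unique)
    show "inner (R x) y = inner x (R y)" for x y
      using P'(6)[OF r[of x] r[of y]] by (simp add: R inner_diff_left inner_diff_right)
    show "norm R \<le> 1" by (rule norm_blinfun_bound) (simp_all add: R norm_r)
    show "norm (id_blinfun - R) \<le> 1"
      by (rule norm_blinfun_bound) (simp_all add: R norm_diff blinfun.diff_left)
  qed
qed

text \<open>With \<open>R = (1 + P)\<^sup>-\<^sup>1\<close> and commuting positive roots \<open>U\<close> of \<open>R\<close> and \<open>V\<close> of \<open>1 - R\<close>, formally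
  \<open>P = (1 - R) R\<^sup>-\<^sup>1\<close> and its root is \<open>V U\<^sup>-\<^sup>1\<close>, with graph \<open>{(U x, V x)}\<close>. Self-adjointness and the
  equation for the square both rest on \<open>U\<^sup>2 + V\<^sup>2 = 1\<close>: if \<open>V y = U z\<close>, then \<open>(y, z) = (U x, V x)\<close> for
  \<open>x = U y + V z\<close>. Positivity is that of the product \<open>U V\<close>, for which \<open>U\<close> is written as the square
  of a symmetric \<open>W\<close> that commutes with \<open>V\<close>.\<close>

lemma pos_sa_sqrt_exists:
  fixes P :: "'a::{real_inner,banach} graph"
  assumes P: "pos_sa P"
  shows "\<exists>S. pos_sa S \<and> S O S = P"
proof -
  obtain R :: "'a \<Rightarrow>\<^sub>L 'a" where R: "\<And>x y. (x, y) \<in> P \<longleftrightarrow> x = R (x + y)"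
    and R_sym: "\<And>x y. inner (R x) y = inner x (R y)"
    and R_norm: "norm R \<le> 1" "norm (id_blinfun - R) \<le> 1"
    by (rule pos_sa_resolvent[OF P]) (rule that)
  have R_inj: "x = 0" if "R x = 0" for x
    using pos_sa_single_valued[OF P] R[of 0 x] that single_valued_iff[OF pos_sa_subspace[OF P]]
    by simp
  define R' where "R' = id_blinfun - R"
  have R': "R' x = x - R x" for x by (simp add: R'_def blinfun.diff_left)
  have R'_sym: "inner (R' x) y = inner x (R' y)" for x y
    by (simp add: R' inner_diff_left inner_diff_right R_sym)
  have R'_norm: "norm (id_blinfun - R') \<le> 1" using R_norm by (simp add: R'_def)
  obtain V :: "'a \<Rightarrow>\<^sub>L 'a" where V: "\<And>x. V (V x) = R' x"
    and V_sym: "\<And>x y. inner (V x) y = inner x (V y)" and V_pos: "\<And>x. 0 \<le> inner (V x) x"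
    and V_comm: "\<And>Z :: 'a \<Rightarrow>\<^sub>L 'a. \<forall>x. Z (R' x) = R' (Z x) \<Longrightarrow> \<forall>x. Z (V x) = V (Z x)"
    by (rule blinfun_sqrt[OF R'_norm R'_sym]) (rule that)
  obtain U :: "'a \<Rightarrow>\<^sub>L 'a" where U: "\<And>x. U (U x) = R x"
    and U_sym: "\<And>x y. inner (U x) y = inner x (U y)"
    and U_norm: "norm (id_blinfun - U) \<le> 1"
    by (rule blinfun_sqrt[OF R_norm(2) R_sym]) (rule that)
  have "U (R x) = R (U x)" for x by (simp flip: U)
  then have UV: "U (V x) = V (U x)" for x
    using V_comm[of U] by (simp add: R' blinfun.diff_right)
  obtain W :: "'a \<Rightarrow>\<^sub>L 'a" where W: "\<And>x. W (W x) = U x"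
    and W_sym: "\<And>x y. inner (W x) y = inner x (W y)"
    and W_comm: "\<And>Z :: 'a \<Rightarrow>\<^sub>L 'a. \<forall>x. Z (U x) = U (Z x) \<Longrightarrow> \<forall>x. Z (W x) = W (Z x)"
    by (rule blinfun_sqrt[OF U_norm U_sym]) (rule that)
  have WV: "V (W x) = W (V x)" for x using W_comm[of V] UV by simp
  have key: "\<exists>x. y = U x \<and> z = V x" if "V y = U z" for y z
  proof (intro exI conjI)
    have "V (U y) = R z" "U (V z) = R' y" using that UV U V by metis+
    then show "y = U (U y + V z)" "z = V (U y + V z)"
      by (simp_all add: blinfun.add_right U V R')
  qed
  define S where "S = range (\<lambda>x. (U x, V x))"
  have S_E: "\<exists>a. x = U a \<and> y = V a" if "(x, y) \<in> S" for x y
    using that by (auto simp: S_def)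
  have "single_valued S"
  proof (rule single_valuedI)
    fix x y z assume "(x, y) \<in> S" "(x, z) \<in> S"
    then obtain a b where ab: "x = U a" "y = V a" "x = U b" "z = V b" using S_E by meson
    then have "R (a - b) = 0" using U[of a] U[of b] by (simp add: blinfun.diff_right)
    then have "a - b = 0" by (rule R_inj)
    then show "y = z" using ab by simp
  qed
  moreover have "adj S = S"
  proof (intro set_eqI iffI; clarify)
    fix y z assume yz: "(y, z) \<in> adj S"
    have "inner x (V y - U z) = 0" for x
      using adjD[OF yz, of "U x" "V x"] by (simp add: S_def inner_diff_right U_sym V_sym)
    then have "V y - U z = 0" by (metis inner_eq_zero_iff)
    then show "(y, z) \<in> S" using key[of y z] by (auto simp: S_def)
  next
    fix y z assume "(y, z) \<in> S"
    then obtain a where a: "y = U a" "z = V a" using S_E by blast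
    show "(y, z) \<in> adj S"
    proof (rule adjI)
      fix x w assume "(x, w) \<in> S"
      then obtain b where "x = U b" "w = V b" using S_E by blast
      then show "inner w y = inner x z" by (simp add: a U_sym V_sym UV)
    qed
  qed
  moreover have "0 \<le> inner y x" if xy: "(x, y) \<in> S" for x y
  proof -
    obtain a where a: "x = U a" "y = V a" using S_E[OF xy] by blast
    have "inner y x = inner (W (V a)) (W a)" by (simp add: a W_sym flip: W)
    also have "\<dots> = inner (V (W a)) (W a)" by (simp add: WV)
    finally show ?thesis using V_pos[of "W a"] by simp
  qed
  ultimately have "pos_sa S" by (auto simp: pos_sa_def)
  moreover have "S O S = P"
  proof (intro set_eqI iffI; clarify)
    fix x y z assume "(x, y) \<in> S" "(y, z) \<in> S"
    then obtain a b where ab: "x = U a" "y = V a" "y = U b" "z = V b" using S_E by meson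
    then obtain c where "a = U c" "b = V c" using key[of a b] by auto
    then have "x = R c" "z = c - R c" by (simp_all add: ab U V R')
    then show "(x, z) \<in> P" by (simp add: R)
  next
    fix x y assume "(x, y) \<in> P"
    then have x: "x = R (x + y)" by (simp only: R)
    define h where "h = x + y"
    have "R h = x" using x by (simp only: h_def)
    then have "U (U h) = x" "V (V h) = y" by (simp_all add: U V R' h_def)
    moreover have "(U (U h), V (U h)) \<in> S" "(U (V h), V (V h)) \<in> S" unfolding S_def by blast+
    ultimately have "(x, V (U h)) \<in> S" "(V (U h), y) \<in> S" by (simp_all add: UV)
    then show "(x, y) \<in> S O S" by blast
  qed
  ultimately show ?thesis by blast
qed

text \<open>Heinz's theorem for the roots \<open>S'\<close> of \<open>S\<close> and \<open>T'\<close> of \<open>T\<close>: on the domain of \<open>S\<close>, a core for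
  \<open>S'\<close>, the inequality \<open>\<langle>T x, x\<rangle> \<le> \<langle>S x, x\<rangle>\<close> reads \<open>\<parallel>T' x\<parallel>\<^sup>2 \<le> \<parallel>S' x\<parallel>\<^sup>2\<close>.\<close>

lemma sqrt_dominated:
  fixes S T S' T' :: "'a::{real_inner,banach} graph"
  assumes S: "pos_sa S" and T: "pos_sa T" and S': "pos_sa S'" and T': "pos_sa T'"
    and sq: "S' O S' = S" "T' O T' = T"
    and dom: "\<And>x y. (x, y) \<in> S \<Longrightarrow> \<exists>w. (x, w) \<in> T \<and> norm w \<le> norm y"
    and xy: "(x, y) \<in> S'"
  shows "\<exists>w. (x, w) \<in> T' \<and> norm w \<le> norm y"
proof (rule dominated_on_closure)
  let ?C = "{(x, y) \<in> S'. y \<in> Domain (adj S')}"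
  note s' = pos_saD[OF S'] and t' = pos_saD[OF T']
  show "subspace T'" "single_valued T'" "closed T'" using t' by auto
  show "subspace ?C" "(x, y) \<in> closure ?C"
    using adj_comp_core[OF s'(4,1,5)] xy by auto
  fix u v assume "(u, v) \<in> ?C"
  then obtain z where z: "(u, v) \<in> S'" "(v, z) \<in> S'" using s'(2) by auto
  then have uz: "(u, z) \<in> S" using sq by blast
  then obtain p where p: "(u, p) \<in> T" using dom by blast
  then obtain w where w: "(u, w) \<in> T'" "(w, p) \<in> T'" using sq by blast
  have "inner p u \<le> inner z u"
    using heinz_inequality[OF S pos_saD(1)[OF T] _ dom uz p] pos_saD(2)[OF T] by simp
  moreover have "inner p u = inner w w" "inner z u = inner v v"
    using t'(6)[OF w(2,1)] s'(6)[OF z(2,1)] by simp_all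
  ultimately have "norm w \<le> norm v" by (simp add: norm_eq_sqrt_inner)
  then show "\<exists>w. (u, w) \<in> T' \<and> norm w \<le> norm v" using w(1) by blast
qed

section \<open>Complex linearity\<close>

definition complex_homogeneous :: "'a::complex_hilbert_space graph \<Rightarrow> bool" where
  "complex_homogeneous T \<longleftrightarrow> (\<forall>c x y. (x, y) \<in> T \<longrightarrow> (c *\<^sub>C x, c *\<^sub>C y) \<in> T)"

lemma complex_homogeneousD: "complex_homogeneous T \<Longrightarrow> (x, y) \<in> T \<Longrightarrow> (c *\<^sub>C x, c *\<^sub>C y) \<in> T"
  by (simp add: complex_homogeneous_def)

lemma cinner_scaleC_right: "cinner x (c *\<^sub>C y) = cnj c * cinner x y"
  by (metis cinner_commute cinner_scaleC_left complex_cnj_mult)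

lemma inner_scaleC_left: "inner (c *\<^sub>C x) y = inner x (cnj c *\<^sub>C y)"
  by (simp add: inner_eq_Re_cinner cinner_scaleC_left cinner_scaleC_right)

lemma scaleC_one: "1 *\<^sub>C x = x" for x :: "'a::complex_hilbert_space"
  using scaleC_of_real[of 1 x] by simp

lemma norm_scaleC: "norm (c *\<^sub>C x) = cmod c * norm x" for x :: "'a::complex_hilbert_space"
proof -
  have "(norm (c *\<^sub>C x))\<^sup>2 = inner x ((cnj c * c) *\<^sub>C x)"
    by (simp add: power2_norm_eq_inner inner_scaleC_left scaleC_scaleC)
  also have "cnj c * c = complex_of_real ((cmod c)\<^sup>2)"
    by (simp add: complex_norm_square mult.commute del: of_real_power)
  also have "inner x (complex_of_real ((cmod c)\<^sup>2) *\<^sub>C x) = (cmod c * norm x)\<^sup>2"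
    unfolding scaleC_of_real by (simp add: power_mult_distrib power2_norm_eq_inner)
  finally show ?thesis by (simp add: power2_eq_iff_nonneg)
qed

lemma bounded_linear_scaleC: "bounded_linear (\<lambda>x :: 'a::complex_hilbert_space. c *\<^sub>C x)"
proof (rule bounded_linear_intro)
  show "c *\<^sub>C (r *\<^sub>R x) = r *\<^sub>R (c *\<^sub>C x)" for r and x :: 'a
    by (simp add: scaleC_scaleC mult.commute flip: scaleC_of_real)
  show "norm (c *\<^sub>C x) \<le> norm x * cmod c" for x :: 'a
    by (simp add: norm_scaleC)
qed (rule scaleC_add_right)

lemma op_app_eq: "single_valued T \<Longrightarrow> (x, y) \<in> T \<Longrightarrow> op_app T x = y"
  unfolding op_app_def by (auto dest: single_valuedD)

text \<open>The imaginary part of \<open>cinner x z\<close> is recovered from the pair \<open>(\<i> x, \<i> w)\<close>.\<close>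

lemma op_adj_eq_adj:
  assumes "complex_homogeneous T" shows "op_adj T = adj T"
proof (intro set_eqI iffI; clarify)
  fix y z assume "(y, z) \<in> op_adj T"
  then show "(y, z) \<in> adj T" by (intro adjI) (auto simp: op_adj_def inner_eq_Re_cinner)
next
  fix y z assume yz: "(y, z) \<in> adj T"
  have "cinner w y = cinner x z" if xw: "(x, w) \<in> T" for x w
  proof (rule complex_eqI)
    show "Re (cinner w y) = Re (cinner x z)"
      using adjD[OF yz xw] by (simp add: inner_eq_Re_cinner)
    show "Im (cinner w y) = Im (cinner x z)"
      using adjD[OF yz complex_homogeneousD[OF assms xw, of \<i>]]
      by (simp add: inner_eq_Re_cinner cinner_scaleC_left)
  qed
  then show "(y, z) \<in> op_adj T" by (auto simp: op_adj_def)
qed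

lemma complex_homogeneous_op_adj: "complex_homogeneous (op_adj T)"
  by (fastforce simp: complex_homogeneous_def op_adj_def cinner_scaleC_right)

lemma positive_selfadjoint_iff:
  "positive_selfadjoint T \<longleftrightarrow> pos_sa T \<and> complex_homogeneous T"
proof
  assume T: "positive_selfadjoint T"
  then have hom: "complex_homogeneous T" and sv: "single_valued T"
    by (simp_all add: positive_selfadjoint_def densely_defined_def linear_operator_def
        complex_homogeneous_def)
  have "0 \<le> inner y x" if xy: "(x, y) \<in> T" for x y
    using T DomainI[OF xy] op_app_eq[OF sv xy]
    by (auto simp: positive_selfadjoint_def inner_eq_Re_cinner)
  then show "pos_sa T \<and> complex_homogeneous T"
    using T hom sv op_adj_eq_adj[OF hom] by (auto simp: pos_sa_def positive_selfadjoint_def)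
next
  assume "pos_sa T \<and> complex_homogeneous T"
  then have T: "pos_sa T" and hom: "complex_homogeneous T" by auto
  note T' = pos_saD[OF T]
  have adj: "op_adj T = T" using op_adj_eq_adj[OF hom] T'(2) by simp
  have "cinner (op_app T x) x \<in> \<real> \<and> 0 \<le> Re (cinner (op_app T x) x)" if x: "x \<in> Domain T" for x
  proof -
    obtain y where y: "(x, y) \<in> T" using x by blast
    have "(x, y) \<in> op_adj T" using y adj by simp
    then have "cinner y x = cinner x y" using y by (auto simp: op_adj_def)
    then have "cinner y x \<in> \<real>" by (metis cinner_commute Reals_cnj_iff)
    then show ?thesis using op_app_eq[OF T'(1) y] T'(3)[OF y] by (simp add: inner_eq_Re_cinner)
  qed
  then show "positive_selfadjoint T"
    using T' adj hom pos_sa_dense[OF T]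
    by (auto simp: positive_selfadjoint_def densely_defined_def linear_operator_def
        complex_homogeneous_def)
qed

text \<open>Conjugating a square root of \<open>P\<close> by a scalar of modulus one gives another square root, hence
  the same one.\<close>

lemma sqrt_complex_homogeneous:
  fixes S :: "'a::complex_hilbert_space graph"
  assumes S: "pos_sa S" and P: "complex_homogeneous (S O S)"
  shows "complex_homogeneous S"
  unfolding complex_homogeneous_def
proof (intro allI impI)
  note S' = pos_saD[OF S]
  fix c x y assume xy: "(x, y) \<in> S"
  have rotate: "(v *\<^sub>C x, v *\<^sub>C y) \<in> S" if v: "cnj v * v = 1" for v
  proof -
    have inv: "cnj v *\<^sub>C (v *\<^sub>C a) = a" "v *\<^sub>C (cnj v *\<^sub>C a) = a" for a :: 'a
      using v by (simp_all add: scaleC_scaleC scaleC_one mult.commute)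
    define T where "T = {(a, b). (v *\<^sub>C a, v *\<^sub>C b) \<in> S}"
    have "pos_sa T"
      unfolding pos_sa_def
    proof (intro conjI)
      show "single_valued T"
      proof (rule single_valuedI)
        fix a b d assume "(a, b) \<in> T" "(a, d) \<in> T"
        then have "v *\<^sub>C b = v *\<^sub>C d" using S'(1) by (auto simp: T_def dest: single_valuedD)
        then show "b = d" by (metis inv(1))
      qed
      show "\<forall>(a, b)\<in>T. 0 \<le> inner b a"
      proof clarify
        fix a b assume "(a, b) \<in> T"
        then have "0 \<le> inner (v *\<^sub>C b) (v *\<^sub>C a)" using S'(3) by (simp add: T_def)
        then show "0 \<le> inner b a" by (simp add: inner_scaleC_left inv)
      qed
      have "(a, b) \<in> adj T \<longleftrightarrow> (v *\<^sub>C a, v *\<^sub>C b) \<in> adj S" for a b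
      proof
        assume ab: "(a, b) \<in> adj T"
        show "(v *\<^sub>C a, v *\<^sub>C b) \<in> adj S"
        proof (rule adjI)
          fix p q assume "(p, q) \<in> S"
          then have "(cnj v *\<^sub>C p, cnj v *\<^sub>C q) \<in> T" by (simp add: T_def inv)
          from adjD[OF ab this] show "inner q (v *\<^sub>C a) = inner p (v *\<^sub>C b)"
            by (simp add: inner_scaleC_left)
        qed
      next
        assume ab: "(v *\<^sub>C a, v *\<^sub>C b) \<in> adj S"
        show "(a, b) \<in> adj T"
        proof (rule adjI)
          fix p q assume "(p, q) \<in> T"
          then have "(v *\<^sub>C p, v *\<^sub>C q) \<in> S" by (simp add: T_def)
          from adjD[OF ab this] show "inner q a = inner p b"
            by (simp add: inner_scaleC_left inv)
        qed
      qed
      then show "adj T = T" using S'(2) by (auto simp: T_def)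
    qed
    moreover have "T O T = S O S"
    proof (intro set_eqI iffI; clarify)
      fix a b d assume "(a, b) \<in> T" "(b, d) \<in> T"
      then have "(v *\<^sub>C a, v *\<^sub>C d) \<in> S O S" by (auto simp: T_def)
      from complex_homogeneousD[OF P this, of "cnj v"] show "(a, d) \<in> S O S" by (simp add: inv)
    next
      fix a b d assume "(a, b) \<in> S" "(b, d) \<in> S"
      then have "(v *\<^sub>C a, v *\<^sub>C d) \<in> S O S" using complex_homogeneousD[OF P] by blast
      then obtain e where "(v *\<^sub>C a, e) \<in> S" "(e, v *\<^sub>C d) \<in> S" by blast
      then have "(a, cnj v *\<^sub>C e) \<in> T" "(cnj v *\<^sub>C e, d) \<in> T" by (simp_all add: T_def inv)
      then show "(a, d) \<in> T O T" by blast
    qed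
    ultimately have "T = S" using pos_sa_square_inject[OF _ S] by blast
    then have "(x, y) \<in> T" using xy by simp
    then show ?thesis by (simp add: T_def)
  qed
  show "(c *\<^sub>C x, c *\<^sub>C y) \<in> S"
  proof (cases "c = 0")
    case True
    have "(0, 0) \<in> S" using subspace_0[OF S'(4)] by (simp add: zero_prod_def)
    then show ?thesis using True scaleC_of_real[of 0 x] scaleC_of_real[of 0 y] by simp
  next
    case False
    have "cnj (sgn c) * sgn c = complex_of_real ((cmod (sgn c))\<^sup>2)"
      by (simp add: complex_norm_square mult.commute del: of_real_power)
    then have "cnj (sgn c) * sgn c = 1" using False by (simp add: norm_sgn)
    then have "(cmod c *\<^sub>R (sgn c *\<^sub>C x), cmod c *\<^sub>R (sgn c *\<^sub>C y)) \<in> S"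
      using graph_scale[OF S'(4) rotate] by blast
    moreover have "cmod c *\<^sub>R (sgn c *\<^sub>C a) = c *\<^sub>C a" for a :: 'a
    proof -
      have "complex_of_real (cmod c) * sgn c = c" using False by (simp add: sgn_eq)
      then show ?thesis by (simp add: scaleC_scaleC flip: scaleC_of_real)
    qed
    ultimately show ?thesis by simp
  qed
qed

section \<open>Absolute values and their order\<close>

lemma op_sqrt_positive_selfadjoint:
  assumes "positive_selfadjoint P"
  shows "positive_selfadjoint (op_sqrt P)" and "op_sqrt P O op_sqrt P = P"
proof -
  have P: "pos_sa P" "complex_homogeneous P" using assms positive_selfadjoint_iff by auto
  obtain S where S: "pos_sa S" "S O S = P" using pos_sa_sqrt_exists[OF P(1)] by blast
  have "\<exists>!S. positive_selfadjoint S \<and> op_comp S S = P"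
  proof
    show "positive_selfadjoint S \<and> op_comp S S = P"
      using S P(2) sqrt_complex_homogeneous[of S] by (simp add: positive_selfadjoint_iff op_comp_def)
    show "T = S" if "positive_selfadjoint T \<and> op_comp T T = P" for T
      using that S pos_sa_square_inject[of T S] by (simp add: positive_selfadjoint_iff op_comp_def)
  qed
  from theI'[OF this] show "positive_selfadjoint (op_sqrt P)" "op_sqrt P O op_sqrt P = P"
    by (simp_all add: op_sqrt_def op_comp_def)
qed

lemma op_abs_positive_selfadjoint:
  assumes T: "linear_operator T" "closed T" "closure (Domain T) = UNIV"
  shows "positive_selfadjoint (op_abs T)" and "op_abs T O op_abs T = T O adj T"
proof -
  have T': "single_valued T" "subspace T" "complex_homogeneous T"
    using T(1) by (simp_all add: linear_operator_def complex_homogeneous_def)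
  have comp: "op_comp (op_adj T) T = T O adj T"
    by (simp add: op_comp_def op_adj_eq_adj[OF T'(3)])
  have "complex_homogeneous (adj T)"
    using complex_homogeneous_op_adj[of T] op_adj_eq_adj[OF T'(3)] by simp
  then have "complex_homogeneous (T O adj T)"
    using T'(3) unfolding complex_homogeneous_def by blast
  then have "positive_selfadjoint (T O adj T)"
    using adj_comp_pos_sa[OF T'(2,1) T(2,3)] by (simp add: positive_selfadjoint_iff)
  from op_sqrt_positive_selfadjoint[OF this]
  show "positive_selfadjoint (op_abs T)" "op_abs T O op_abs T = T O adj T"
    by (simp_all add: op_abs_def comp)
qed

text \<open>The absolute value and the operator share \<open>T\<^sup>*T\<close>, hence domain and norms.\<close>

lemma op_abs_norm_le:
  assumes T: "linear_operator T" "closed T" "closure (Domain T) = UNIV"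
  shows "(x, y) \<in> op_abs T \<Longrightarrow> \<exists>w. (x, w) \<in> T \<and> norm w \<le> norm y"
    and "(x, w) \<in> T \<Longrightarrow> \<exists>y. (x, y) \<in> op_abs T \<and> norm y \<le> norm w"
proof -
  have T': "single_valued T" "subspace T" using T(1) by (simp_all add: linear_operator_def)
  have "pos_sa (op_abs T)"
    using op_abs_positive_selfadjoint(1)[OF T] by (simp add: positive_selfadjoint_iff)
  note S' = pos_saD[OF this]
  have eq: "op_abs T O adj (op_abs T) = T O adj T"
    using op_abs_positive_selfadjoint(2)[OF T] S'(2) by simp
  show "(x, y) \<in> op_abs T \<Longrightarrow> \<exists>w. (x, w) \<in> T \<and> norm w \<le> norm y"
    by (rule same_adj_comp_dominated[OF S'(4,1,5) T'(2,1) T(2)]) (simp_all add: eq)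
  show "(x, w) \<in> T \<Longrightarrow> \<exists>y. (x, y) \<in> op_abs T \<and> norm y \<le> norm w"
    by (rule same_adj_comp_dominated[OF T'(2,1) T(2) S'(4,1,5)]) (simp_all add: eq)
qed

text \<open>The norm comparison of \<open>S\<close> and \<open>T\<close> carries over to \<open>|S|\<close> and \<open>|T|\<close>, and from there to their
  square roots by Heinz's theorem.\<close>

lemma op_abs_mono:
  assumes S: "linear_operator S" "closed S" "closure (Domain S) = UNIV"
    and T: "linear_operator T" "closed T" "closure (Domain T) = UNIV"
    and dom: "\<And>x w. (x, w) \<in> S \<Longrightarrow> \<exists>v. (x, v) \<in> T \<and> norm v \<le> norm w"
  shows "op_le (op_abs T) (op_abs S)"
proof -
  let ?S = "op_abs S" and ?T = "op_abs T"
  note S' = op_abs_positive_selfadjoint(1)[OF S] and T' = op_abs_positive_selfadjoint(1)[OF T]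
  note rS = op_sqrt_positive_selfadjoint[OF S'] and rT = op_sqrt_positive_selfadjoint[OF T']
  have abs_dom: "\<exists>w. (x, w) \<in> ?T \<and> norm w \<le> norm y" if xy: "(x, y) \<in> ?S" for x y
  proof -
    obtain w where w: "(x, w) \<in> S" "norm w \<le> norm y" using op_abs_norm_le(1)[OF S xy] by blast
    obtain v where v: "(x, v) \<in> T" "norm v \<le> norm w" using dom[OF w(1)] by blast
    obtain u where "(x, u) \<in> ?T" "norm u \<le> norm v" using op_abs_norm_le(2)[OF T v(1)] by blast
    then show ?thesis using w(2) v(2) by (meson order_trans)
  qed
  have sqrt_dom: "\<exists>w. (x, w) \<in> op_sqrt ?T \<and> norm w \<le> norm y" if "(x, y) \<in> op_sqrt ?S" for x y
    using sqrt_dominated[of ?S ?T "op_sqrt ?S" "op_sqrt ?T", OF _ _ _ _ rS(2) rT(2) abs_dom that]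
      S' T' rS(1) rT(1) by (simp add: positive_selfadjoint_iff)
  have "norm (op_app (op_sqrt ?T) x) \<le> norm (op_app (op_sqrt ?S) x) \<and> x \<in> Domain (op_sqrt ?T)"
    if x: "x \<in> Domain (op_sqrt ?S)" for x
  proof -
    obtain y where y: "(x, y) \<in> op_sqrt ?S" using x by blast
    obtain w where w: "(x, w) \<in> op_sqrt ?T" "norm w \<le> norm y" using sqrt_dom[OF y] by blast
    have "single_valued (op_sqrt ?S)" "single_valued (op_sqrt ?T)"
      using rS(1) rT(1) by (simp_all add: positive_selfadjoint_iff pos_sa_def)
    then show ?thesis using op_app_eq y w by (metis DomainI)
  qed
  then show ?thesis using S' T' by (auto simp: op_le_def)
qed

section \<open>The real part of a hyponormal operator\<close>

lemma closure_complex_homogeneous: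
  fixes T :: "'a::complex_hilbert_space graph"
  assumes "complex_homogeneous T" shows "complex_homogeneous (closure T)"
  unfolding complex_homogeneous_def
proof (intro allI impI)
  fix c x y assume "(x, y) \<in> closure T"
  then obtain s where s: "\<And>n. s n \<in> T" "s \<longlonglongrightarrow> (x, y)" by (auto simp: closure_sequential)
  have "(c *\<^sub>C fst (s n), c *\<^sub>C snd (s n)) \<in> T" for n
    using complex_homogeneousD[OF assms] s(1) by simp
  moreover have "(\<lambda>n. (c *\<^sub>C fst (s n), c *\<^sub>C snd (s n))) \<longlonglongrightarrow> (c *\<^sub>C x, c *\<^sub>C y)"
    using tendsto_fst[OF s(2)] tendsto_snd[OF s(2)]
    by (intro tendsto_Pair bounded_linear.tendsto[OF bounded_linear_scaleC]) auto
  ultimately show "(c *\<^sub>C x, c *\<^sub>C y) \<in> closure T"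
    unfolding closure_sequential
    by (intro exI[of _ "\<lambda>n. (c *\<^sub>C fst (s n), c *\<^sub>C snd (s n))"]) auto
qed

text \<open>A symmetric operator is closable because its closure stays inside its adjoint, which is closed
  and single-valued.\<close>

lemma closure_symmetric:
  fixes T :: "'a::complex_hilbert_space graph"
  assumes "subspace T" "complex_homogeneous T" "closure (Domain T) = UNIV" "T \<subseteq> adj T"
  shows "linear_operator (closure T)" and "closure (Domain (closure T)) = UNIV"
proof -
  have "closure T \<subseteq> adj T" using assms(4) closed_adj by (rule closure_minimal)
  then have "single_valued (closure T)"
    using single_valued_adj[OF assms(1,3)] single_valued_subset by blast
  then show "linear_operator (closure T)"
    using subspace_closure[OF assms(1)] closure_complex_homogeneous[OF assms(2)]
    by (simp add: linear_operator_def complex_homogeneous_def)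
  have "Domain T \<subseteq> Domain (closure T)" using closure_subset by (rule Domain_mono)
  then show "closure (Domain (closure T)) = UNIV" using closure_mono assms(3) by blast
qed

lemma op_Re_conv:
  assumes T: "densely_defined T"
  shows "op_Re T = {(x, (1/2) *\<^sub>R (w + z)) | x w z. (x, w) \<in> T \<and> (x, z) \<in> adj T}"
proof -
  have T': "single_valued T" "subspace T" "complex_homogeneous T" "closure (Domain T) = UNIV"
    using T by (simp_all add: densely_defined_def linear_operator_def complex_homogeneous_def)
  have adj: "op_adj T = adj T" by (rule op_adj_eq_adj[OF T'(3)])
  have sv: "single_valued (adj T)" by (rule single_valued_adj[OF T'(2,4)])
  have half: "(1/2) *\<^sub>C a = (1/2) *\<^sub>R a" for a :: 'a
    using scaleC_of_real[of "1/2" a] by simp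
  show ?thesis
    unfolding op_Re_def adj half using op_app_eq[OF T'(1)] op_app_eq[OF sv] by blast
qed

lemma op_Re_symmetric:
  assumes T: "densely_defined T"
  shows "subspace (op_Re T)" "complex_homogeneous (op_Re T)" "op_Re T \<subseteq> adj (op_Re T)"
proof -
  have T': "single_valued T" "subspace T" "complex_homogeneous T" "closure (Domain T) = UNIV"
    using T by (simp_all add: densely_defined_def linear_operator_def complex_homogeneous_def)
  have homa: "complex_homogeneous (adj T)"
    using complex_homogeneous_op_adj[of T] op_adj_eq_adj[OF T'(3)] by simp
  have I: "(x, y) \<in> op_Re T" if "(x, w) \<in> T" "(x, z) \<in> adj T" "y = (1/2) *\<^sub>R (w + z)" for x y w z
    using that by (auto simp: op_Re_conv[OF T])
  have E: thesis if "p \<in> op_Re T" "\<And>x w z. p = (x, (1/2) *\<^sub>R (w + z)) \<Longrightarrow> (x, w) \<in> T \<Longrightarrow> (x, z) \<in> adj T \<Longrightarrow> thesis"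
    for p thesis
    using that by (auto simp: op_Re_conv[OF T])
  show "subspace (op_Re T)"
    unfolding subspace_def
  proof (intro conjI ballI allI)
    show "0 \<in> op_Re T"
      unfolding zero_prod_def
      by (rule I[of 0 0 0])
        (use subspace_0[OF T'(2)] subspace_0[OF subspace_adj[of T]] in \<open>simp_all add: zero_prod_def\<close>)
  next
    fix p q assume "p \<in> op_Re T" "q \<in> op_Re T"
    then obtain x w z x' w' z'
      where p: "p = (x, (1/2) *\<^sub>R (w + z))" "(x, w) \<in> T" "(x, z) \<in> adj T"
        and q: "q = (x', (1/2) *\<^sub>R (w' + z'))" "(x', w') \<in> T" "(x', z') \<in> adj T"
      by (elim E) blast
    show "p + q \<in> op_Re T"
      unfolding p(1) q(1) add_Pair
      by (rule I[OF graph_add[OF T'(2) p(2) q(2)] graph_add[OF subspace_adj p(3) q(3)]])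
        (simp add: algebra_simps)
  next
    fix c :: real and p assume "p \<in> op_Re T"
    then obtain x w z where p: "p = (x, (1/2) *\<^sub>R (w + z))" "(x, w) \<in> T" "(x, z) \<in> adj T"
      by (elim E) blast
    show "c *\<^sub>R p \<in> op_Re T"
      unfolding p(1) scaleR_Pair
      by (rule I[OF graph_scale[OF T'(2) p(2)] graph_scale[OF subspace_adj p(3)]])
        (simp add: algebra_simps)
  qed
  show "complex_homogeneous (op_Re T)"
    unfolding complex_homogeneous_def
  proof (intro allI impI)
    fix c x y assume "(x, y) \<in> op_Re T"
    then obtain w z where y: "y = (1/2) *\<^sub>R (w + z)" "(x, w) \<in> T" "(x, z) \<in> adj T"
      by (elim E) blast
    show "(c *\<^sub>C x, c *\<^sub>C y) \<in> op_Re T"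
      by (rule I[OF complex_homogeneousD[OF T'(3) y(2)] complex_homogeneousD[OF homa y(3)]])
        (simp add: y(1) bounded_linear.linear[OF bounded_linear_scaleC] linear_scale scaleC_add_right)
  qed
  show "op_Re T \<subseteq> adj (op_Re T)"
  proof
    fix p assume "p \<in> op_Re T"
    then obtain x w z where p: "p = (x, (1/2) *\<^sub>R (w + z))" "(x, w) \<in> T" "(x, z) \<in> adj T"
      by (elim E) blast
    show "p \<in> adj (op_Re T)"
      unfolding p(1)
    proof (rule adjI)
      fix a b assume "(a, b) \<in> op_Re T"
      then obtain w' z' where b: "b = (1/2) *\<^sub>R (w' + z')" "(a, w') \<in> T" "(a, z') \<in> adj T"
        by (elim E) blast
      show "inner b x = inner a ((1/2) *\<^sub>R (w + z))"
        using adjD[OF p(3) b(2)] adjD[OF b(3) p(2)]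
        by (simp add: b(1) inner_add_left inner_add_right inner_commute)
    qed
  qed
qed

theorem proposition3p5:
  fixes A :: "'a::complex_hilbert_space graph"
  assumes "linear_operator A" and "closed A" and "hyponormal A"
  shows "op_le (op_abs (closure (op_Re A))) (op_abs A)"
proof -
  have dd: "densely_defined A" and sub: "Domain A \<subseteq> Domain (op_adj A)"
    and le: "\<And>x. x \<in> Domain A \<Longrightarrow> norm (op_app (op_adj A) x) \<le> norm (op_app A x)"
    using assms(3) by (auto simp: hyponormal_def)
  have A: "single_valued A" "subspace A" "complex_homogeneous A" "closure (Domain A) = UNIV"
    using dd by (simp_all add: densely_defined_def linear_operator_def complex_homogeneous_def)
  have adj: "op_adj A = adj A" by (rule op_adj_eq_adj[OF A(3)])
  have sv: "single_valued (adj A)" by (rule single_valued_adj[OF A(2,4)])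
  have bound: "\<exists>v. (x, v) \<in> op_Re A \<and> norm v \<le> norm w" if xw: "(x, w) \<in> A" for x w
  proof -
    obtain z where z: "(x, z) \<in> adj A" using xw sub adj by blast
    have "norm z \<le> norm w"
      using le[of x] op_app_eq[OF A(1) xw] op_app_eq[OF sv z] xw adj by auto
    then have "norm ((1/2) *\<^sub>R (w + z)) \<le> norm w"
      using norm_triangle_ineq[of w z] by simp
    moreover have "(x, (1/2) *\<^sub>R (w + z)) \<in> op_Re A"
      using xw z by (auto simp: op_Re_conv[OF dd])
    ultimately show ?thesis by blast
  qed
  then have "Domain A \<subseteq> Domain (op_Re A)" by blast
  then have dense: "closure (Domain (op_Re A)) = UNIV" using closure_mono A(4) by blast
  show ?thesis
  proof (rule op_abs_mono[OF assms(1,2) A(4)])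
    show "linear_operator (closure (op_Re A))" "closure (Domain (closure (op_Re A))) = UNIV"
      using closure_symmetric[OF op_Re_symmetric(1,2)[OF dd] dense op_Re_symmetric(3)[OF dd]] by auto
    show "closed (closure (op_Re A))" by simp
    show "\<exists>v. (x, v) \<in> closure (op_Re A) \<and> norm v \<le> norm w" if "(x, w) \<in> A" for x w
      using bound[OF that] closure_subset by blast
  qed
qed

end
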